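(* Let $f:\mathbb{R}^d\to\mathbb{R}$ be twice differentiable and $\mu$-strongly convex with $\mu>0$, let $\nabla f$ be Lipschitz continuous with constant $L>0$, and let $\nabla^2 f$ be Lipschitz continuous with constant $M>0$ (i.e. $\|\nabla^2f(x)-\nabla^2f(y)\|\le M\|x-y\|$ for all $x,y$). Let $\kappa=L/\mu$ and let $x_*$ be the minimizer of $f$. Let $\{x_t\}_{t\ge 0}$ be the iterates generated by BFGS, where at every iteration the step size satisfies the Armijo-Wolfe conditions with parameters $\alpha,\beta$. Then for any initial point $x_0\in\mathbb{R}^d$ and any symmetric positive definite initial Hessian approximation matrix $B_0$, if $$t\ge\Psi(\tilde B_0)+3C_0\Psi(\bar B_0)+\frac{9}{\alpha(1-\beta)}C_0\kappa,$$ then $$\frac{f(x_t)-f(x_* )}{f(x_0)-f(x_* )}\le\left(1-\frac{2\alpha(1-\beta)}{3}\right)^{t}.$$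
   Context: BFGS method: given $x_0\in\mathbb{R}^d$ and a symmetric positive definite $B_0\in\mathbb{R}^{d\times d}$, for $t\ge0$ set $g_t=\nabla f(x_t)$, $d_t=-B_t^{-1}g_t$, $x_{t+1}=x_t+\eta_t d_t$ with step size $\eta_t>0$, $s_t=x_{t+1}-x_t$, $y_t=\nabla f(x_{t+1})-\nabla f(x_t)$, and $$B_{t+1}=B_t-\frac{B_ts_ts_t^\top B_t}{s_t^\top B_ts_t}+\frac{y_ty_t^\top}{s_t^\top y_t}.$$ The iterates are assumed non-optimal ($g_t\neq0$), so that all quantities are well defined. Armijo-Wolfe conditions on $\eta_t$, with parameters $0<\alpha<\beta<1$ and $0<\alpha<\frac12$: $$f(x_t+\eta_td_t)\le f(x_t)+\alpha\eta_t\nabla f(x_t)^\top d_t,\qquad \nabla f(x_t+\eta_td_t)^\top d_t\ge\beta\nabla f(x_t)^\top d_t.$$ For symmetric positive definite $A\in\mathbb{R}^{d\times d}$, $\Psi(A):=\mathrm{Tr}(A)-d-\log\mathrm{Det}(A)$. Also $\bar B_0:=\frac1LB_0$, $\tilde B_0:=\nabla^2f(x_* )^{-1/2}B_0\nabla^2f(x_* )^{-1/2}$, and $C_t:=\frac{M}{\mu^{3/2}}\sqrt{2(f(x_t)-f(x_* ))}$ for $t\ge0$. *)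

theory Defs
  imports "HOL-Analysis.Analysis"
begin

(* The gradient vector, unique (hence independent of the choice) wherever f is differentiable. *)
definition gradient :: "(real ^ 'n \<Rightarrow> real) \<Rightarrow> real ^ 'n \<Rightarrow> real ^ 'n" where
  "gradient f x = (SOME D. GDERIV f x :> D)"

definition hessian :: "(real ^ 'n \<Rightarrow> real) \<Rightarrow> real ^ 'n \<Rightarrow> real ^ 'n ^ 'n" where
  "hessian f x = jacobian (gradient f) (at x)"

definition twice_differentiable :: "(real ^ 'n \<Rightarrow> real) \<Rightarrow> bool" where
  "twice_differentiable f \<longleftrightarrow> (\<forall>x. f differentiable at x \<and> gradient f differentiable at x)"

definition strongly_convex_on :: "real \<Rightarrow> 'a::real_inner set \<Rightarrow> ('a \<Rightarrow> real) \<Rightarrow> bool" where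
  "strongly_convex_on \<mu> S f \<longleftrightarrow> convex S \<and>
     (\<forall>x\<in>S. \<forall>y\<in>S. \<forall>u\<ge>0. \<forall>v\<ge>0. u + v = 1 \<longrightarrow>
        f (u *\<^sub>R x + v *\<^sub>R y) \<le> u * f x + v * f y - \<mu> / 2 * u * v * (norm (x - y))\<^sup>2)"

definition spectral_norm :: "real ^ 'n ^ 'm \<Rightarrow> real" where
  "spectral_norm A = onorm ((*v) A)"

definition spd :: "real ^ 'n ^ 'n \<Rightarrow> bool" where
  "spd A \<longleftrightarrow> transpose A = A \<and> (\<forall>x. x \<noteq> 0 \<longrightarrow> x \<bullet> (A *v x) > 0)"

(* Meant for symmetric positive definite A, for which the spd square root is unique. *)
definition spd_sqrt :: "real ^ 'n ^ 'n \<Rightarrow> real ^ 'n ^ 'n" where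
  "spd_sqrt A = (SOME S. spd S \<and> S ** S = A)"

definition outer_prod :: "real ^ 'n \<Rightarrow> real ^ 'n \<Rightarrow> real ^ 'n ^ 'n" where
  "outer_prod u v = (\<chi> i j. u $ i * v $ j)"

definition bfgs_direction :: "(real ^ 'n \<Rightarrow> real) \<Rightarrow> real ^ 'n \<Rightarrow> real ^ 'n ^ 'n \<Rightarrow> real ^ 'n" where
  "bfgs_direction f x B = - (matrix_inv B *v gradient f x)"

definition bfgs_update :: "real ^ 'n ^ 'n \<Rightarrow> real ^ 'n \<Rightarrow> real ^ 'n \<Rightarrow> real ^ 'n ^ 'n" where
  "bfgs_update B s y =
     B - (1 / (s \<bullet> (B *v s))) *\<^sub>R (B ** outer_prod s s ** B)
       + (1 / (s \<bullet> y)) *\<^sub>R outer_prod y y"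

(* The clause on the gradient excludes termination at the minimizer, so that all search
   directions are non-zero and the update is always well defined. *)
definition bfgs_sequence ::
  "(real ^ 'n \<Rightarrow> real) \<Rightarrow> (nat \<Rightarrow> real ^ 'n) \<Rightarrow> (nat \<Rightarrow> real ^ 'n ^ 'n) \<Rightarrow> (nat \<Rightarrow> real) \<Rightarrow> bool" where
  "bfgs_sequence f x B \<eta> \<longleftrightarrow>
     (\<forall>t. gradient f (x t) \<noteq> 0 \<and> \<eta> t > 0 \<and>
          x (Suc t) = x t + \<eta> t *\<^sub>R bfgs_direction f (x t) (B t) \<and>
          B (Suc t) = bfgs_update (B t) (x (Suc t) - x t)
                        (gradient f (x (Suc t)) - gradient f (x t)))"

definition armijo_wolfe ::
  "(real ^ 'n \<Rightarrow> real) \<Rightarrow> real \<Rightarrow> real \<Rightarrow> real ^ 'n \<Rightarrow> real ^ 'n \<Rightarrow> real \<Rightarrow> bool" where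
  "armijo_wolfe f \<alpha> \<beta> x d \<eta> \<longleftrightarrow>
     f (x + \<eta> *\<^sub>R d) \<le> f x + \<alpha> * \<eta> * (gradient f x \<bullet> d) \<and>
     gradient f (x + \<eta> *\<^sub>R d) \<bullet> d \<ge> \<beta> * (gradient f x \<bullet> d)"

definition Psi :: "real ^ 'n ^ 'n \<Rightarrow> real" where
  "Psi A = trace A - real CARD('n) - ln (det A)"

definition B_bar :: "real \<Rightarrow> real ^ 'n ^ 'n \<Rightarrow> real ^ 'n ^ 'n" where
  "B_bar L B = (1 / L) *\<^sub>R B"

definition B_tilde ::
  "(real ^ 'n \<Rightarrow> real) \<Rightarrow> real ^ 'n \<Rightarrow> real ^ 'n ^ 'n \<Rightarrow> real ^ 'n ^ 'n" where
  "B_tilde f xstar B =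
     (let R = matrix_inv (spd_sqrt (hessian f xstar)) in R ** B ** R)"

definition C_of ::
  "real \<Rightarrow> real \<Rightarrow> (real ^ 'n \<Rightarrow> real) \<Rightarrow> real ^ 'n \<Rightarrow> real ^ 'n \<Rightarrow> real" where
  "C_of M \<mu> f xstar x = M / \<mu> powr (3 / 2) * sqrt (2 * (f x - f xstar))"

end

theory Submission
  imports Defs
begin

text \<open>
  Write \<open>h\<^sub>i = f (x\<^sub>i) - f (x\<^sub>*)\<close>, and let \<open>s\<^sub>i\<close>, \<open>y\<^sub>i\<close>, \<open>g\<^sub>i\<close> be the step, the gradient
  difference and the gradient. Fix a symmetric invertible \<open>R\<close> and measure steps in the norm
  \<open>\<parallel>R\<inverse> s\<parallel>\<close>, gradients in the dual norm \<open>\<parallel>R g\<parallel>\<close>; the method is invariant under this change of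
  variables, which turns \<open>B\<^sub>i\<close> into \<open>R B\<^sub>i R\<close>. Two facts drive the proof.

  First, \<open>\<Psi> (R B\<^sub>i R)\<close> is a nonnegative potential. Trace and determinant of the update are explicit,
  and they show (\<open>Psi_decrease_lower_bounds_progress\<close>) that \<open>\<Psi>\<close> must decrease, which it cannot do
  too often, when the ratio \<open>w\<^sub>i = (s\<^sub>i \<bullet> B\<^sub>i s\<^sub>i)\<^sup>2 / (\<parallel>R B\<^sub>i s\<^sub>i\<parallel>\<^sup>2 (s\<^sub>i \<bullet> y\<^sub>i))\<close> is small:
  \<open>ln w\<^sub>i \<ge> \<Psi>\<^sub>i\<^sub>+\<^sub>1 - \<Psi>\<^sub>i + 1 - \<parallel>R y\<^sub>i\<parallel>\<^sup>2 / (s\<^sub>i \<bullet> y\<^sub>i)\<close>.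
  Second, the Armijo-Wolfe conditions turn \<open>w\<^sub>i\<close> into progress (\<open>relative_decrease_lower_bound\<close>): if
  \<open>\<parallel>R g\<^sub>i\<parallel>\<^sup>2 \<ge> 2 c\<^sub>i h\<^sub>i\<close>, then \<open>1 - h\<^sub>i\<^sub>+\<^sub>1 / h\<^sub>i \<ge> 2 \<alpha> (1 - \<beta>) c\<^sub>i w\<^sub>i\<close>. Summing logarithms, the potential
  telescopes, so the geometric mean of the relative decreases is bounded below, and concavity of
  \<open>u \<mapsto> ln (1 - exp u)\<close> converts this into a linear rate for \<open>h\<close>. The result is
  \<open>bfgs_rate_in_metric\<close>: the rate is \<open>1 - 2 \<alpha> (1 - \<beta>) \<rho> / 3\<close> once the number of iterations exceeds
  \<open>\<Psi> (R B\<^sub>0 R)\<close> plus the accumulated errors in \<open>\<parallel>R y\<^sub>i\<parallel>\<^sup>2 \<le> s\<^sub>i \<bullet> y\<^sub>i\<close> and \<open>\<parallel>R g\<^sub>i\<parallel>\<^sup>2 \<ge> 2 \<rho> h\<^sub>i\<close>.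
  The factor 3 stands for \<open>exp 1\<close>.

  It is applied twice. With \<open>R = L\<^sup>-\<^sup>1\<^sup>/\<^sup>2 I\<close> there are no errors but \<open>\<rho> = 1/\<kappa>\<close>; this gives a global
  linear rate after \<open>\<Psi> (B\<^sub>0 / L)\<close> iterations. Consequently the numbers \<open>C\<^sub>i\<close>, which are proportional
  to \<open>sqrt h\<^sub>i\<close>, have a sum of at most \<open>C\<^sub>0 (\<Psi> (B\<^sub>0 / L) + 3 \<kappa> / (\<alpha> (1 - \<beta>)))\<close>. With
  \<open>R = (\<nabla>\<^sup>2 f (x\<^sub>*))\<^sup>-\<^sup>1\<^sup>/\<^sup>2\<close> one has \<open>\<rho> = 1\<close>, and since all Hessians involved lie between \<open>1 / (1 + C\<^sub>i)\<close>
  and \<open>1 + C\<^sub>i\<close> times the Hessian at \<open>x\<^sub>*\<close>, both errors are at most \<open>C\<^sub>i\<close>. Their total is controlled by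
  the bound just obtained, and the threshold for \<open>t\<close> provides for it.
\<close>

section \<open>Spectral decomposition and square roots of symmetric matrices\<close>

lemma inner_matrix_vector_transpose:
  fixes A :: "real ^ 'n ^ 'm"
  shows "x \<bullet> (A *v y) = (transpose A *v x) \<bullet> y"
  by (metis dot_lmul_matrix transpose_matrix_vector)

text \<open>
  If steps are measured through \<open>S = R\<inverse>\<close> and gradients through \<open>R\<close>, then pairings of a step with a
  gradient do not change.
\<close>

lemma inner_inverse_pair:
  fixes R S :: "real ^ 'n ^ 'n"
  assumes "transpose R = R" "R ** S = mat 1"
  shows "(S *v u) \<bullet> (R *v v) = u \<bullet> v"
  using assms by (simp add: inner_matrix_vector_transpose[of _ R] matrix_vector_mul_assoc
      del: transpose_matrix_vector)

text \<open>
  The maximizer of the Rayleigh quotient on the unit sphere of an invariant subspace is an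
  eigenvector: with \<open>U = l - T\<close>, where \<open>l\<close> is the maximum, the quadratic form of \<open>U\<close> is nonnegative
  and vanishes at the maximizer \<open>v\<close>, and moving from \<open>v\<close> in the direction \<open>- U v\<close> would make it
  negative unless \<open>U v = 0\<close>.
\<close>

lemma rayleigh_max_eigenvector:
  fixes T :: "'a::euclidean_space \<Rightarrow> 'a"
  assumes T: "linear T" and sym: "\<And>u v. u \<bullet> T v = T u \<bullet> v"
    and S: "subspace S" "T ` S \<subseteq> S" "S \<noteq> {0}"
  obtains v l where "v \<in> S" "norm v = 1" "T v = l *\<^sub>R v"
proof -
  interpret T: linear T by (rule T)
  have "0 \<in> S" using S(1) by (rule subspace_0)
  with S(3) obtain u where u: "u \<in> S" "u \<noteq> 0" by blast
  have "inverse (norm u) *\<^sub>R u \<in> sphere 0 1 \<inter> S"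
    using u S(1) by (simp add: subspace_scale)
  then have ne: "sphere 0 1 \<inter> S \<noteq> {}" by blast
  have "compact (sphere 0 1 \<inter> S)"
    using S(1) by (intro compact_Int_closed closed_subspace) auto
  moreover have "continuous_on (sphere 0 1 \<inter> S) (\<lambda>w. w \<bullet> T w)"
    using T by (intro continuous_intros linear_continuous_on linear_linear[THEN iffD1])
      (simp add: linear_conv_bounded_linear)
  ultimately obtain v where v: "v \<in> sphere 0 1 \<inter> S"
    and max: "\<And>w. w \<in> sphere 0 1 \<inter> S \<Longrightarrow> w \<bullet> T w \<le> v \<bullet> T v"
    using continuous_attains_sup[OF _ ne] by blast
  define l where "l = v \<bullet> T v"
  define Q where "Q w = l * (w \<bullet> w) - w \<bullet> T w" for w
  have Q_nonneg: "Q w \<ge> 0" if "w \<in> S" for w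
  proof (cases "w = 0")
    case False
    have "inverse (norm w) *\<^sub>R w \<in> sphere 0 1 \<inter> S"
      using that False S(1) by (simp add: subspace_scale)
    from max[OF this] have "(w \<bullet> T w) / (norm w)\<^sup>2 \<le> l"
      by (simp add: l_def T.scale power2_eq_square field_simps)
    then show ?thesis
      using False by (simp add: Q_def field_simps power2_norm_eq_inner)
  qed (simp add: Q_def T.zero)
  have vS: "v \<in> S" and nv: "norm v = 1" using v by auto
  have vv: "v \<bullet> v = 1" using nv by (simp add: norm_eq_1)
  define r where "r = l *\<^sub>R v - T v"
  have rS: "r \<in> S"
    using S(1,2) vS unfolding r_def by (intro subspace_diff subspace_scale) auto
  have Q_line: "Q (v - e *\<^sub>R r) = e\<^sup>2 * Q r - 2 * e * (r \<bullet> r)" for e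
  proof -
    define U where "U w = l *\<^sub>R w - T w" for w
    have Q: "Q w = w \<bullet> U w" for w by (simp add: Q_def U_def inner_diff_right)
    have "U (v - e *\<^sub>R r) = r - e *\<^sub>R U r"
      by (simp add: U_def r_def T.diff T.scale scaleR_diff_right mult.commute)
    moreover have "v \<bullet> U r = r \<bullet> r"
    proof -
      have "v \<bullet> U r = (l *\<^sub>R v - T v) \<bullet> r"
        using sym[of v r] by (simp add: U_def inner_diff_left inner_diff_right)
      then show ?thesis by (simp add: r_def)
    qed
    moreover have "v \<bullet> r = 0" using vv by (simp add: r_def inner_diff_right l_def)
    ultimately have "Q (v - e *\<^sub>R r) = - (e * (r \<bullet> r)) - e * (r \<bullet> r - e * (r \<bullet> U r))"
      by (simp add: Q inner_diff_left inner_diff_right)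
    then show ?thesis by (simp add: Q power2_eq_square algebra_simps)
  qed
  have "r \<bullet> r = 0"
  proof (rule ccontr)
    assume "r \<bullet> r \<noteq> 0"
    then have pos: "r \<bullet> r > 0" by (metis inner_gt_zero_iff inner_eq_zero_iff)
    \<comment> \<open>For small \<open>e\<close> the linear term of \<open>Q_line\<close> dominates. This \<open>e\<close> is small enough, and adding 1
      avoids a case distinction on \<open>Q r = 0\<close>.\<close>
    define e where "e = (r \<bullet> r) / (Q r + 1)"
    have q: "Q r \<ge> 0" by (rule Q_nonneg[OF rS])
    have e: "e > 0" using q pos by (simp add: e_def)
    have "e * Q r \<le> r \<bullet> r" using q pos by (simp add: e_def field_simps)
    moreover have "Q (v - e *\<^sub>R r) \<ge> 0"
      using S(1) vS rS by (intro Q_nonneg subspace_diff subspace_scale)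
    ultimately have "0 \<le> e * (e * Q r - 2 * (r \<bullet> r))"
      by (simp add: Q_line power2_eq_square algebra_simps)
    then show False using e pos \<open>e * Q r \<le> r \<bullet> r\<close> by (simp add: zero_le_mult_iff)
  qed
  then have "T v = l *\<^sub>R v" by (simp add: r_def)
  with vS nv show thesis by (rule that)
qed

text \<open>
  Induction on the dimension: the orthogonal complement, within \<open>S\<close>, of an eigenvector is again
  invariant because \<open>T\<close> is self-adjoint.
\<close>

lemma orthonormal_eigenbasis_subspace:
  fixes T :: "'a::euclidean_space \<Rightarrow> 'a"
  assumes T: "linear T" and sym: "\<And>u v. u \<bullet> T v = T u \<bullet> v"
    and S: "subspace S" "T ` S \<subseteq> S"
  shows "\<exists>E. E \<subseteq> S \<and> finite E \<and> card E = dim S \<and> pairwise orthogonal E \<and>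
    (\<forall>b\<in>E. norm b = 1 \<and> (\<exists>l. T b = l *\<^sub>R b))"
  using S
proof (induction "dim S" arbitrary: S)
  case 0
  then show ?case by (intro exI[of _ "{}"]) auto
next
  case (Suc n)
  interpret T: linear T by (rule T)
  have "S \<noteq> {0}" using Suc.hyps(2) by auto
  with rayleigh_max_eigenvector[OF T sym Suc.prems] obtain v l
    where v: "v \<in> S" "norm v = 1" "T v = l *\<^sub>R v" by blast
  define S' where "S' = {y \<in> S. orthogonal v y}"
  have S': "subspace S'"
    unfolding S'_def using Suc.prems(1) subspace_orthogonal_to_vector[of v]
    by (auto simp: subspace_def orthogonal_def inner_simps)
  have inv: "T ` S' \<subseteq> S'"
    using Suc.prems(2) sym[of v] v(3) by (auto simp: S'_def orthogonal_def)
  have "dim {y \<in> S. \<forall>x\<in>span {v}. orthogonal x y} + dim (span {v}) = dim S"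
    using v(1) Suc.prems(1)
    by (intro dim_subspace_orthogonal_to_vectors) (auto simp: span_minimal)
  moreover have "{y \<in> S. \<forall>x\<in>span {v}. orthogonal x y} = S'"
    by (auto simp: S'_def span_singleton orthogonal_def span_base)
  moreover have "dim {v} = 1" using v(2) by (simp add: dim_insert) auto
  ultimately have "n = dim S'" using Suc.hyps(2) by simp
  from Suc.hyps(1)[OF this S' inv] obtain E where E: "E \<subseteq> S'" "finite E" "card E = n"
    "pairwise orthogonal E" "\<forall>b\<in>E. norm b = 1 \<and> (\<exists>l. T b = l *\<^sub>R b)"
    using \<open>n = dim S'\<close> by blast
  have "v \<notin> E"
    using E(1) v(2) by (auto simp: S'_def orthogonal_def norm_eq_1)
  then show ?case
    using E v Suc.hyps(2)
    by (intro exI[of _ "insert v E"])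
      (auto simp: S'_def pairwise_insert orthogonal_commute)
qed

definition diag_matrix :: "('n \<Rightarrow> real) \<Rightarrow> real ^ 'n ^ 'n" where
  "diag_matrix l = (\<chi> i j. if i = j then l i else 0)"

lemma transpose_diag_matrix [simp]: "transpose (diag_matrix l) = diag_matrix l"
  by (simp add: diag_matrix_def transpose_def vec_eq_iff)

lemma diag_matrix_vector_nth: "(diag_matrix l *v x) $ i = l i * x $ i"
  by (simp add: diag_matrix_def matrix_vector_mult_def if_distrib[where f = "\<lambda>u. u * _"]
      cong: if_cong)

lemma diag_matrix_mult: "diag_matrix k ** diag_matrix l = diag_matrix (\<lambda>i. k i * l i)"
  by (simp add: matrix_eq matrix_vector_mul_assoc[symmetric] vec_eq_iff diag_matrix_vector_nth
      mult.assoc)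

lemma inner_diag_matrix: "x \<bullet> (diag_matrix l *v x) = (\<Sum>i\<in>UNIV. l i * (x $ i)\<^sup>2)"
  by (simp add: inner_vec_def diag_matrix_vector_nth power2_eq_square mult.left_commute)

lemma det_diag_matrix: "det (diag_matrix l) = (\<Prod>i\<in>UNIV. l i)"
  by (subst det_diagonal) (auto simp: diag_matrix_def)

lemma trace_diag_matrix: "trace (diag_matrix l) = (\<Sum>i\<in>UNIV. l i)"
  by (simp add: trace_def diag_matrix_def)

theorem symmetric_matrix_diagonalizable:
  fixes A :: "real ^ 'n ^ 'n"
  assumes "transpose A = A"
  obtains P l where "orthogonal_matrix P" "A = P ** diag_matrix l ** transpose P"
proof -
  have sym: "u \<bullet> (A *v v) = (A *v u) \<bullet> v" for u v
    by (metis assms inner_matrix_vector_transpose)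
  obtain E where E: "finite E" "card E = CARD('n)" "pairwise orthogonal E"
    "\<forall>b\<in>E. norm b = 1 \<and> (\<exists>l. A *v b = l *\<^sub>R b)"
    using orthonormal_eigenbasis_subspace[OF matrix_vector_mul_linear sym, of UNIV] by auto
  obtain b :: "'n \<Rightarrow> real ^ 'n" where b: "bij_betw b UNIV E"
    using E(1,2) by (metis finite bij_betw_iff_card)
  have bE: "b i \<in> E" for i using b by (auto simp: bij_betw_def)
  have "\<forall>i. \<exists>l. A *v b i = l *\<^sub>R b i" using E(4) bE by blast
  then obtain l where l: "\<And>i. A *v b i = l i *\<^sub>R b i" by metis
  define P :: "real ^ 'n ^ 'n" where "P = (\<chi> i j. b j $ i)"
  have col: "column j P = b j" for j by (simp add: P_def column_def)
  have orth: "orthogonal_matrix P"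
    unfolding orthogonal_matrix_orthonormal_columns col
  proof (intro conjI allI impI)
    show "norm (b i) = 1" for i using E(4) bE by blast
    show "orthogonal (b i) (b j)" if "i \<noteq> j" for i j
    proof -
      have "b i \<noteq> b j" using that b by (auto simp: bij_betw_def inj_on_def)
      then show ?thesis using E(3) bE[of i] bE[of j] by (auto simp: pairwise_def)
    qed
  qed
  have "A ** P = P ** diag_matrix l"
  proof -
    have "(A ** P) $ i $ j = (P ** diag_matrix l) $ i $ j" for i j
    proof -
      have "(A ** P) $ i $ j = (A *v b j) $ i"
        by (simp add: P_def matrix_matrix_mult_def matrix_vector_mult_def)
      also have "\<dots> = (P ** diag_matrix l) $ i $ j"
        by (simp add: l P_def matrix_matrix_mult_def diag_matrix_def mult.commute
            if_distrib[where f = "\<lambda>u. _ * u"] cong: if_cong)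
      finally show ?thesis .
    qed
    then show ?thesis by (simp add: vec_eq_iff)
  qed
  then have "A ** P ** transpose P = P ** diag_matrix l ** transpose P" by simp
  then have "A = P ** diag_matrix l ** transpose P"
    using orth by (simp add: orthogonal_matrix_def matrix_mul_assoc[symmetric])
  with orth show thesis by (rule that)
qed

lemma congruence_inner:
  fixes P :: "real ^ 'n ^ 'n"
  shows "x \<bullet> ((P ** D ** transpose P) *v x) = (transpose P *v x) \<bullet> (D *v (transpose P *v x))"
  by (simp add: inner_matrix_vector_transpose[of x P] matrix_vector_mul_assoc[symmetric])

lemma spd_congruence:
  fixes A P :: "real ^ 'n ^ 'n"
  assumes "spd A" "invertible P"
  shows "spd (P ** A ** transpose P)"
proof -
  have "transpose P *v x \<noteq> 0" if "x \<noteq> 0" for x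
  proof
    assume "transpose P *v x = 0"
    moreover have "invertible (transpose P)" using assms(2) by (simp add: invertible_det_nz)
    then obtain Q where "Q ** transpose P = mat 1" unfolding invertible_def by blast
    ultimately have "x = 0"
      by (metis matrix_vector_mul_assoc matrix_vector_mul_lid matrix_vector_mult_0_right)
    with that show False by simp
  qed
  then show ?thesis
    using assms(1) unfolding spd_def congruence_inner
    by (simp add: matrix_transpose_mul matrix_mul_assoc)
qed

lemma spd_diag_matrix_iff: "spd (diag_matrix l) \<longleftrightarrow> (\<forall>i. l i > 0)"
proof
  assume "spd (diag_matrix l)"
  then have "axis i 1 \<bullet> (diag_matrix l *v axis i 1) > 0" for i
    by (simp add: spd_def axis_eq_0_iff)
  then show "\<forall>i. l i > 0"
    by (simp add: inner_axis' diag_matrix_vector_nth)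
next
  assume l: "\<forall>i. l i > 0"
  have "(\<Sum>i\<in>UNIV. l i * (x $ i)\<^sup>2) > 0" if x: "x \<noteq> 0" for x :: "real ^ 'a"
  proof -
    from x obtain i where "x $ i \<noteq> 0" by (auto simp: vec_eq_iff)
    then show ?thesis
      using l by (intro sum_pos2[of _ i]) (auto simp: less_imp_le)
  qed
  then show "spd (diag_matrix l)" by (simp add: spd_def inner_diag_matrix)
qed

lemma spd_diagonalization:
  fixes A :: "real ^ 'n ^ 'n"
  assumes "spd A"
  obtains P l where "orthogonal_matrix P" "\<forall>i. l i > 0" "A = P ** diag_matrix l ** transpose P"
proof -
  obtain P l where P: "orthogonal_matrix P" and A: "A = P ** diag_matrix l ** transpose P"
    using symmetric_matrix_diagonalizable[of A] assms by (auto simp: spd_def)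
  have inv: "invertible (transpose P)"
    using P unfolding orthogonal_matrix_def invertible_def by blast
  have "transpose P ** A ** transpose (transpose P) =
      (transpose P ** P) ** diag_matrix l ** (transpose P ** P)"
    unfolding A by (simp add: matrix_mul_assoc)
  also have "\<dots> = diag_matrix l" using P by (simp add: orthogonal_matrix)
  finally have "spd (diag_matrix l)" using spd_congruence[OF assms inv] by simp
  with P A show thesis by (intro that) (auto simp: spd_diag_matrix_iff)
qed

text \<open>
  The matrix chosen by \<open>spd_sqrt\<close> exists: replace the eigenvalues of \<open>A\<close> by their square roots.
\<close>

lemma spd_sqrt:
  fixes A :: "real ^ 'n ^ 'n"
  assumes "spd A"
  shows spd_spd_sqrt: "spd (spd_sqrt A)" and spd_sqrt_square: "spd_sqrt A ** spd_sqrt A = A"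
proof -
  obtain P l where P: "orthogonal_matrix P" and l: "\<forall>i. l i > 0"
    and A: "A = P ** diag_matrix l ** transpose P"
    using spd_diagonalization[OF assms] by blast
  define S where "S = P ** diag_matrix (\<lambda>i. sqrt (l i)) ** transpose P"
  have "invertible P" using P unfolding orthogonal_matrix_def invertible_def by blast
  then have "spd S"
    unfolding S_def using l by (intro spd_congruence) (simp_all add: spd_diag_matrix_iff)
  moreover have "S ** S = A"
  proof -
    have PP: "transpose P ** P = mat 1" using P by (simp add: orthogonal_matrix)
    have "S ** S = P ** diag_matrix (\<lambda>i. sqrt (l i)) ** (transpose P ** P) **
        diag_matrix (\<lambda>i. sqrt (l i)) ** transpose P"
      unfolding S_def by (simp add: matrix_mul_assoc)
    also have "\<dots> = P ** (diag_matrix (\<lambda>i. sqrt (l i)) ** diag_matrix (\<lambda>i. sqrt (l i))) **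
        transpose P"
      unfolding PP by (simp add: matrix_mul_assoc)
    also have "\<dots> = A" using l by (simp add: A diag_matrix_mult less_imp_le)
    finally show ?thesis .
  qed
  ultimately have "spd (spd_sqrt A) \<and> spd_sqrt A ** spd_sqrt A = A"
    unfolding spd_sqrt_def by (intro someI[of "\<lambda>S. spd S \<and> S ** S = A" S]) simp
  then show "spd (spd_sqrt A)" "spd_sqrt A ** spd_sqrt A = A" by auto
qed

lemma det_orthogonal_congruence:
  fixes P :: "real ^ 'n ^ 'n"
  assumes "orthogonal_matrix P"
  shows "det (P ** D ** transpose P) = det D"
  using det_orthogonal_matrix[OF assms] by (auto simp: det_mul)

lemma spd_det_pos:
  fixes A :: "real ^ 'n ^ 'n"
  assumes "spd A"
  shows "det A > 0"
proof -
  obtain P l where P: "orthogonal_matrix P" and l: "\<forall>i. l i > 0"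
    and A: "A = P ** diag_matrix l ** transpose P"
    using spd_diagonalization[OF assms] by blast
  show ?thesis
    unfolding A det_orthogonal_congruence[OF P] det_diag_matrix using l by (simp add: prod_pos)
qed

lemma spd_invertible: "spd A \<Longrightarrow> invertible A"
  using spd_det_pos[of A] by (simp add: invertible_det_nz)

text \<open>
  In terms of the eigenvalues \<open>l\<^sub>i\<close> of \<open>A\<close> the potential is the sum of the nonnegative numbers
  \<open>l\<^sub>i - 1 - ln l\<^sub>i\<close>.
\<close>

lemma Psi_nonneg:
  fixes A :: "real ^ 'n ^ 'n"
  assumes "spd A"
  shows "Psi A \<ge> 0"
proof -
  obtain P l where P: "orthogonal_matrix P" and l: "\<forall>i. l i > 0"
    and A: "A = P ** diag_matrix l ** transpose P"
    using spd_diagonalization[OF assms] by blast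
  have "trace A = trace (transpose P ** (P ** diag_matrix l))"
    unfolding A by (rule trace_mul_sym)
  also have "\<dots> = (\<Sum>i\<in>UNIV. l i)"
    using P by (simp add: matrix_mul_assoc orthogonal_matrix trace_diag_matrix)
  finally have "trace A = (\<Sum>i\<in>UNIV. l i)" .
  moreover have "ln (det A) = (\<Sum>i\<in>UNIV. ln (l i))"
    unfolding A det_orthogonal_congruence[OF P] det_diag_matrix using l
    by (subst ln_prod) (auto simp: less_imp_neq[symmetric])
  ultimately have "Psi A = (\<Sum>i\<in>UNIV. l i - 1 - ln (l i))"
    by (simp add: Psi_def sum_subtractf)
  also have "\<dots> \<ge> 0"
    using l ln_le_minus_one by (intro sum_nonneg) (simp add: algebra_simps)
  finally show ?thesis .
qed

section \<open>The BFGS update and the potential\<close>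

lemma outer_prod_vector: "outer_prod u v *v x = (v \<bullet> x) *\<^sub>R u"
  by (simp add: outer_prod_def matrix_vector_mult_def inner_vec_def vec_eq_iff sum_distrib_right
      sum_distrib_left mult_ac)

lemma matrix_mult_outer_prod: "A ** outer_prod u v = outer_prod (A *v u) v"
  by (simp add: matrix_eq matrix_vector_mul_assoc[symmetric] outer_prod_vector
      matrix_vector_mult_scaleR)

lemma outer_prod_mult_matrix:
  fixes A :: "real ^ 'n ^ 'n"
  shows "outer_prod u v ** A = outer_prod u (transpose A *v v)"
  by (simp add: matrix_eq matrix_vector_mul_assoc[symmetric] outer_prod_vector
      inner_matrix_vector_transpose)

lemma trace_outer_prod: "trace (outer_prod u v) = u \<bullet> v"
  by (simp add: trace_def outer_prod_def inner_vec_def)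

text \<open>
  The determinant is invariant under orthogonal congruence, so \<open>v\<close> may be taken to be a multiple of a
  coordinate vector. Then the matrix differs from the identity in a single column and Cramer's rule
  applies.
\<close>

lemma det_mat_1_plus_outer_prod:
  fixes u v :: "real ^ 'n"
  shows "det (mat 1 + outer_prod u v) = 1 + u \<bullet> v"
proof (cases "v = 0")
  case True
  then have "outer_prod u v = 0" by (simp add: outer_prod_def vec_eq_iff)
  with True show ?thesis by simp
next
  case False
  define k where "k = (undefined :: 'n)"
  define n where "n = norm v"
  have n: "n \<noteq> 0" using False by (simp add: n_def)
  obtain Q :: "real ^ 'n ^ 'n" where Q: "orthogonal_matrix Q"
    and Qk: "Q *v axis k 1 = inverse n *\<^sub>R v"
    using orthogonal_matrix_exists_basis[of "inverse n *\<^sub>R v" k] n by (auto simp: n_def)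
  have QQ: "transpose Q ** Q = mat 1" "Q ** transpose Q = mat 1"
    using Q by (auto simp: orthogonal_matrix_def)
  have QQv: "transpose Q *v (Q *v z) = z" for z
    by (simp only: matrix_vector_mul_assoc QQ matrix_vector_mul_lid)
  have v: "v = n *\<^sub>R (Q *v axis k 1)" using n by (simp add: Qk)
  have Qv: "transpose Q *v v = n *\<^sub>R axis k 1"
    by (simp add: v matrix_vector_mult_scaleR matrix_vector_mul_assoc QQ)
  define w where "w = transpose Q *v u"
  have uv: "u \<bullet> v = n * w $ k"
    unfolding v w_def by (simp add: inner_matrix_vector_transpose inner_axis)
  define y where "y = axis k 1 + n *\<^sub>R w"
  have "transpose Q ** (mat 1 + outer_prod u v) ** Q = mat 1 + outer_prod w (n *\<^sub>R axis k 1)"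
    by (simp add: matrix_eq matrix_vector_mul_assoc[symmetric] matrix_vector_mult_add_rdistrib
        matrix_vector_right_distrib outer_prod_vector matrix_vector_mult_scaleR w_def Qv[symmetric]
        inner_matrix_vector_transpose[of v Q] QQv del: transpose_matrix_vector)
  also have "\<dots> = (\<chi> i j. if j = k then (mat 1 *v y) $ i else (mat 1 :: real ^ 'n ^ 'n) $ i $ j)"
    unfolding matrix_vector_mul_lid by (auto simp: vec_eq_iff outer_prod_def y_def axis_def mat_def)
  finally have "det (transpose Q ** (mat 1 + outer_prod u v) ** transpose (transpose Q)) = y $ k"
    by (simp add: cramer_lemma)
  moreover have "det (transpose Q ** (mat 1 + outer_prod u v) ** transpose (transpose Q)) =
      det (mat 1 + outer_prod u v)"
    using Q by (intro det_orthogonal_congruence) simp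
  ultimately show ?thesis by (simp add: y_def uv)
qed

text \<open>
  The product form of the update: although it is a correction of rank two, it is the congruence by a
  rank-one perturbation \<open>J = I + w s\<^sup>T\<close> of the identity, with \<open>w = c (y - g B s)\<close>,
  \<open>c = 1 / sqrt ((s \<bullet> B s) (s \<bullet> y))\<close> and \<open>g = c (s \<bullet> y)\<close>. Positive definiteness and the determinant of
  the update are immediate from it.
\<close>

lemma bfgs_update_congruence:
  fixes B :: "real ^ 'n ^ 'n"
  assumes B: "spd B" and sy: "s \<bullet> y > 0"
  obtains J where "bfgs_update B s y = J ** B ** transpose J"
    "(det J)\<^sup>2 = (s \<bullet> y) / (s \<bullet> (B *v s))" "det J > 0"
proof -
  define a where "a = s \<bullet> (B *v s)"
  define b where "b = s \<bullet> y"
  have "s \<noteq> 0" using sy by auto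
  then have a: "a > 0" using B by (simp add: a_def spd_def)
  have b: "b > 0" using sy by (simp add: b_def)
  have tB: "transpose B = B" using B by (simp add: spd_def)
  define c where "c = 1 / sqrt (a * b)"
  define g where "g = c * b"
  have c: "c > 0" using a b by (simp add: c_def)
  have "c * c = 1 / (a * b)" using a b by (simp add: c_def)
  then have cab: "c * c * a * b = 1" using a b by simp
  have g: "g > 0" using b c by (simp add: g_def)
  define w where "w = c *\<^sub>R (y - g *\<^sub>R (B *v s))"
  define J where "J = mat 1 + outer_prod w s"
  have tJ: "transpose J = mat 1 + outer_prod s w"
    by (simp add: J_def transpose_def outer_prod_def vec_eq_iff mat_def mult.commute)
  have Jv: "J *v z = z + (s \<bullet> z) *\<^sub>R w" for z
    by (simp add: J_def matrix_vector_mult_add_rdistrib outer_prod_vector)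
  have tJv: "transpose J *v z = z + (w \<bullet> z) *\<^sub>R s" for z
    unfolding tJ by (simp add: matrix_vector_mult_add_rdistrib outer_prod_vector)
  have det: "det J = g"
  proof -
    have "w \<bullet> s = c * (b - g * a)"
      by (simp add: w_def inner_diff_right a_def b_def inner_commute[of _ s])
    then have "det J = 1 + c * b - c * c * a * b"
      by (simp add: J_def det_mat_1_plus_outer_prod g_def algebra_simps)
    then show ?thesis using cab by (simp add: g_def)
  qed
  have "bfgs_update B s y *v x = (J ** B ** transpose J) *v x" for x
  proof -
    define p where "p = y \<bullet> x"
    define q where "q = s \<bullet> (B *v x)"
    define r where "r = w \<bullet> x"
    have Bsx: "(B *v s) \<bullet> x = q" by (metis inner_matrix_vector_transpose q_def tB)
    have r: "r = c * (p - g * q)"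
      by (simp add: r_def w_def inner_diff_left Bsx p_def)
    have "(J ** B ** transpose J) *v x = B *v x + r *\<^sub>R (B *v s) + (q + r * a) *\<^sub>R w"
      by (simp add: matrix_vector_mul_assoc[symmetric] Jv tJv
          matrix_vector_mult_scaleR matrix_vector_right_distrib inner_add_right
          r_def[symmetric] q_def a_def scaleR_add_right scaleR_add_left del: transpose_matrix_vector)
    also have "\<dots> = B *v x + ((q + r * a) * c) *\<^sub>R y + (r - (q + r * a) * c * g) *\<^sub>R (B *v s)"
      by (simp add: w_def scaleR_diff_right scaleR_diff_left mult.assoc)
    \<comment> \<open>Comparison of the coefficients of \<open>y\<close> and of \<open>B s\<close>.\<close>
    also have "(q + r * a) * c = p / b"
    proof -
      have "(q + r * a) * c * b = c * b * q + (c * c * a * b) * (p - c * b * q)"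
        by (simp add: r g_def algebra_simps)
      then have "(q + r * a) * c * b = p" unfolding cab by simp
      then show ?thesis using b by (metis nonzero_mult_div_cancel_right less_irrefl)
    qed
    also have "r - p / b * g = - (q / a)"
    proof -
      have "p / b * g = c * p" using b by (simp add: g_def)
      then have "r - p / b * g = - (c * c * b) * q" by (simp add: r g_def algebra_simps)
      moreover have "c * c * b = 1 / a" using cab a by (simp add: field_simps)
      ultimately show ?thesis by simp
    qed
    also have "B *v x + (p / b) *\<^sub>R y + (- (q / a)) *\<^sub>R (B *v s) = bfgs_update B s y *v x"
      by (simp add: bfgs_update_def matrix_vector_mult_add_rdistrib matrix_vector_mult_diff_rdistrib
          scaleR_matrix_vector_assoc[symmetric] matrix_vector_mul_assoc[symmetric] outer_prod_vector
          matrix_vector_mult_scaleR p_def q_def a_def b_def)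
    finally show ?thesis by simp
  qed
  then have "bfgs_update B s y = J ** B ** transpose J" by (simp add: matrix_eq)
  moreover have "(det J)\<^sup>2 = b / a"
    using cab a by (simp add: det g_def power2_eq_square field_simps)
  ultimately show thesis using g by (intro that) (auto simp: a_def b_def det)
qed

lemma spd_bfgs_update:
  fixes B :: "real ^ 'n ^ 'n"
  assumes "spd B" "s \<bullet> y > 0"
  shows "spd (bfgs_update B s y)"
proof -
  obtain J where J: "bfgs_update B s y = J ** B ** transpose J" "det J > 0"
    using bfgs_update_congruence[OF assms] by blast
  then have "invertible J" by (simp add: invertible_det_nz)
  then show ?thesis unfolding J(1) by (rule spd_congruence[OF assms(1)])
qed

lemma det_bfgs_update:
  fixes B :: "real ^ 'n ^ 'n"
  assumes "spd B" "s \<bullet> y > 0"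
  shows "det (bfgs_update B s y) = (s \<bullet> y) / (s \<bullet> (B *v s)) * det B"
proof -
  obtain J where J: "bfgs_update B s y = J ** B ** transpose J"
    "(det J)\<^sup>2 = (s \<bullet> y) / (s \<bullet> (B *v s))"
    using bfgs_update_congruence[OF assms] by blast
  have "det (bfgs_update B s y) = (det J)\<^sup>2 * det B"
    unfolding J(1) by (simp add: det_mul power2_eq_square)
  then show ?thesis by (simp add: J(2))
qed

lemma trace_scaleR: "trace (c *\<^sub>R A) = c * trace (A :: real ^ 'n ^ 'n)"
  by (simp add: trace_def sum_distrib_left)

lemma trace_bfgs_update:
  fixes B :: "real ^ 'n ^ 'n"
  assumes "transpose B = B"
  shows "trace (bfgs_update B s y) =
    trace B - (norm (B *v s))\<^sup>2 / (s \<bullet> (B *v s)) + (norm y)\<^sup>2 / (s \<bullet> y)"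
  by (simp add: bfgs_update_def trace_add trace_sub trace_scaleR matrix_mult_outer_prod
      outer_prod_mult_matrix assms trace_outer_prod power2_norm_eq_inner)

lemma Psi_bfgs_update:
  fixes B :: "real ^ 'n ^ 'n"
  assumes "spd B" "s \<bullet> y > 0"
  shows "Psi (bfgs_update B s y) = Psi B - (norm (B *v s))\<^sup>2 / (s \<bullet> (B *v s)) +
    (norm y)\<^sup>2 / (s \<bullet> y) - ln ((s \<bullet> y) / (s \<bullet> (B *v s)))"
proof -
  have "s \<noteq> 0" using assms(2) by auto
  then have "s \<bullet> (B *v s) > 0" "transpose B = B" using assms(1) by (auto simp: spd_def)
  moreover from this have "ln (det (bfgs_update B s y)) = ln ((s \<bullet> y) / (s \<bullet> (B *v s))) + ln (det B)"
    unfolding det_bfgs_update[OF assms] using assms(2) spd_det_pos[OF assms(1)]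
    by (intro ln_mult_pos) simp_all
  ultimately show ?thesis
    by (simp add: Psi_def trace_bfgs_update)
qed

text \<open>
  The method is affinely invariant. For this reason one estimate of the potential, in Euclidean
  coordinates, yields the estimate for every metric.
\<close>

lemma bfgs_update_change_of_variables:
  fixes R S :: "real ^ 'n ^ 'n"
  assumes R: "transpose R = R" and RS: "R ** S = mat 1"
    and B: "transpose B = B"
  shows "R ** bfgs_update B s y ** R = bfgs_update (R ** B ** R) (S *v s) (R *v y)"
proof -
  have dual: "(S *v u) \<bullet> (R *v v) = u \<bullet> v" for u v
    by (rule inner_inverse_pair[OF R RS])
  have RSs: "R *v (S *v u) = u" for u by (simp add: matrix_vector_mul_assoc RS)
  have adj: "u \<bullet> (R *v v) = (R *v u) \<bullet> v" for u v
    by (metis R inner_matrix_vector_transpose)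
  show ?thesis
      by (simp add: matrix_eq bfgs_update_def matrix_vector_mult_add_rdistrib
          matrix_vector_mult_diff_rdistrib scaleR_matrix_vector_assoc[symmetric]
          matrix_vector_mul_assoc[symmetric] outer_prod_vector matrix_vector_mult_scaleR
          matrix_vector_right_distrib matrix_vector_mult_diff_distrib RSs dual adj)
qed

text \<open>
  In the coordinates given by \<open>R\<close> the trace contributes \<open>- A + \<parallel>R y\<parallel>\<^sup>2 / (s \<bullet> y)\<close> to the change of the
  potential, where \<open>A = \<parallel>R B s\<parallel>\<^sup>2 / (s \<bullet> B s)\<close>, and the determinant contributes
  \<open>ln ((s \<bullet> B s) / (s \<bullet> y))\<close>. The inequality follows from \<open>ln A \<le> A - 1\<close>. The argument of the
  logarithm on the right is the squared cosine of the angle between \<open>s\<close> and \<open>B s\<close> divided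
  by the curvature \<open>(s \<bullet> y) / \<parallel>S s\<parallel>\<^sup>2\<close>, both in the metric of \<open>R\<close>.
\<close>

lemma Psi_decrease_lower_bounds_progress:
  fixes B R S :: "real ^ 'n ^ 'n"
  assumes B: "spd B" and sy: "s \<bullet> y > 0"
    and R: "transpose R = R" and RS: "R ** S = mat 1"
  shows "Psi (R ** bfgs_update B s y ** R) - Psi (R ** B ** R) + 1 - (norm (R *v y))\<^sup>2 / (s \<bullet> y)
    \<le> ln ((s \<bullet> (B *v s))\<^sup>2 / ((norm (R *v (B *v s)))\<^sup>2 * (s \<bullet> y)))"
proof -
  have dual: "(S *v u) \<bullet> (R *v v) = u \<bullet> v" for u v
    by (rule inner_inverse_pair[OF R RS])
  have RSs: "R *v (S *v u) = u" for u by (simp add: matrix_vector_mul_assoc RS)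
  have "invertible R"
    using RS matrix_left_right_inverse unfolding invertible_def by blast
  from spd_congruence[OF B this] have RBR: "spd (R ** B ** R)" by (simp add: R)
  define a where "a = s \<bullet> (B *v s)"
  define b where "b = s \<bullet> y"
  define n where "n = (norm (R *v (B *v s)))\<^sup>2"
  have "s \<noteq> 0" using sy by auto
  then have a: "a > 0" using B by (simp add: a_def spd_def)
  have b: "b > 0" using sy by (simp add: b_def)
  have "R *v (B *v s) \<noteq> 0"
  proof
    assume "R *v (B *v s) = 0"
    then have "(S *v s) \<bullet> (R *v (B *v s)) = 0" by simp
    with a show False by (simp add: dual a_def)
  qed
  then have n: "n > 0" by (simp add: n_def)
  have "Psi (R ** bfgs_update B s y ** R) = Psi (R ** B ** R) - n / a +
      (norm (R *v y))\<^sup>2 / b - ln (b / a)"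
    using B sy unfolding a_def b_def n_def
    by (subst bfgs_update_change_of_variables[OF R RS], simp add: spd_def,
        subst Psi_bfgs_update[OF RBR])
      (simp_all add: dual RSs matrix_vector_mul_assoc[symmetric])
  moreover have "ln (n / a) \<le> n / a - 1" using n a by (intro ln_le_minus_one) simp
  moreover have "ln (a\<^sup>2 / (n * b)) = - ln (n / a) - ln (b / a)"
    using a b n by (simp add: ln_div ln_mult ln_realpow)
  ultimately show ?thesis unfolding a_def[symmetric] b_def[symmetric] n_def[symmetric] by linarith
qed

section \<open>Gradients and Hessians\<close>

lemma GDERIV_gradient:
  fixes f :: "real ^ 'n \<Rightarrow> real"
  assumes "f differentiable at x"
  shows "GDERIV f x :> gradient f x"
proof -
  obtain f' where f': "(f has_derivative f') (at x)" using assms by (auto simp: differentiable_def)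
  then interpret linear f' by (rule has_derivative_linear)
  have "f' h = h \<bullet> (\<Sum>b\<in>Basis. f' b *\<^sub>R b)" for h
  proof -
    have "f' h = f' (\<Sum>b\<in>Basis. (h \<bullet> b) *\<^sub>R b)" by (simp add: euclidean_representation)
    also have "\<dots> = h \<bullet> (\<Sum>b\<in>Basis. f' b *\<^sub>R b)"
      by (simp add: sum scale inner_sum_right mult.commute)
    finally show ?thesis .
  qed
  then have "f' = (\<lambda>h. h \<bullet> (\<Sum>b\<in>Basis. f' b *\<^sub>R b))" by blast
  with f' have "GDERIV f x :> (\<Sum>b\<in>Basis. f' b *\<^sub>R b)" by (simp add: gderiv_def)
  then show ?thesis unfolding gradient_def by (rule someI)
qed

lemma twice_differentiable_gradient:
  assumes "twice_differentiable f"
  shows "GDERIV f x :> gradient f x"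
  using assms by (simp add: twice_differentiable_def GDERIV_gradient)

lemma twice_differentiable_hessian:
  assumes "twice_differentiable f"
  shows "(gradient f has_derivative (*v) (hessian f x)) (at x)"
  using assms unfolding twice_differentiable_def hessian_def by (metis jacobian_works)

lemma DERIV_along_line:
  fixes f :: "real ^ 'n \<Rightarrow> real"
  assumes "twice_differentiable f"
  shows "((\<lambda>r. f (x + r *\<^sub>R s)) has_real_derivative gradient f (x + r *\<^sub>R s) \<bullet> s) (at r)"
proof -
  have "((\<lambda>r. x + r *\<^sub>R s) has_derivative (\<lambda>h. h *\<^sub>R s)) (at r)"
    by (auto intro!: derivative_eq_intros)
  from has_derivative_compose[OF this, of f "\<lambda>h. h \<bullet> gradient f (x + r *\<^sub>R s)"]
  show ?thesis
    using twice_differentiable_gradient[OF assms, of "x + r *\<^sub>R s"]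
    by (simp add: gderiv_def has_field_derivative_def inner_commute mult_commute_abs)
qed

lemma DERIV_gradient_along_line:
  fixes f :: "real ^ 'n \<Rightarrow> real"
  assumes "twice_differentiable f"
  shows "((\<lambda>r. w \<bullet> gradient f (x + r *\<^sub>R s)) has_real_derivative
    w \<bullet> (hessian f (x + r *\<^sub>R s) *v s)) (at r)"
proof -
  have "((\<lambda>r. x + r *\<^sub>R s) has_derivative (\<lambda>h. h *\<^sub>R s)) (at r)"
    by (auto intro!: derivative_eq_intros)
  from has_derivative_compose[OF this twice_differentiable_hessian[OF assms]]
  have "((\<lambda>r. w \<bullet> gradient f (x + r *\<^sub>R s)) has_derivative
      (\<lambda>h. w \<bullet> (hessian f (x + r *\<^sub>R s) *v (h *\<^sub>R s)))) (at r)"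
    by (rule has_derivative_inner_right)
  then show ?thesis
    by (simp add: has_field_derivative_def matrix_vector_mult_scaleR mult.commute[of _ "w \<bullet> _"])
qed

text \<open>
  The mean value theorem in the direction \<open>u\<close> reduces the second difference to a difference of
  gradients at two points near \<open>x\<close>, which is estimated by the derivative of the gradient at \<open>x\<close> alone.
\<close>

lemma second_difference_estimate:
  fixes f :: "real ^ 'n \<Rightarrow> real"
  assumes f: "twice_differentiable f" and e: "e > 0"
  obtains d where "d > 0" "\<And>h. 0 < h \<Longrightarrow> h < d \<Longrightarrow>
    \<bar>f (x + h *\<^sub>R u + h *\<^sub>R v) - f (x + h *\<^sub>R u) - f (x + h *\<^sub>R v) + f x
      - h\<^sup>2 * (u \<bullet> (hessian f x *v v))\<bar> \<le> e * h\<^sup>2 * (norm u * (2 * norm u + norm v))"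
proof -
  define A where "A = hessian f x"
  define K where "K = norm u + norm v"
  obtain d0 where d0: "d0 > 0"
    "\<And>z. norm (z - x) < d0 \<Longrightarrow> norm (gradient f z - gradient f x - A *v (z - x)) \<le> e * norm (z - x)"
    using twice_differentiable_hessian[OF f, of x] e unfolding has_derivative_at_alt A_def by metis
  define d where "d = d0 / (K + 1)"
  have K: "K \<ge> 0" by (simp add: K_def)
  have d: "d > 0" using d0(1) K by (simp add: d_def)
  have "\<bar>f (x + h *\<^sub>R u + h *\<^sub>R v) - f (x + h *\<^sub>R u) - f (x + h *\<^sub>R v) + f x
      - h\<^sup>2 * (u \<bullet> (A *v v))\<bar> \<le> e * h\<^sup>2 * (norm u * (2 * norm u + norm v))"
    if h: "0 < h" "h < d" for h
  proof -
    define p where "p r = f ((x + h *\<^sub>R v) + r *\<^sub>R u) - f (x + r *\<^sub>R u)" for r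
    have "(p has_real_derivative gradient f ((x + h *\<^sub>R v) + r *\<^sub>R u) \<bullet> u -
        gradient f (x + r *\<^sub>R u) \<bullet> u) (at r)" for r
      unfolding p_def by (intro DERIV_diff DERIV_along_line f)
    then obtain z where z: "0 < z" "z < h" and
      pz: "p h - p 0 = (h - 0) * (gradient f ((x + h *\<^sub>R v) + z *\<^sub>R u) \<bullet> u -
        gradient f (x + z *\<^sub>R u) \<bullet> u)"
      using MVT2[of 0 h p "\<lambda>r. gradient f ((x + h *\<^sub>R v) + r *\<^sub>R u) \<bullet> u -
        gradient f (x + r *\<^sub>R u) \<bullet> u"] h(1) by blast
    define a where "a = h *\<^sub>R v + z *\<^sub>R u"
    define b where "b = z *\<^sub>R u"
    define ra where "ra = gradient f (x + a) - gradient f x - A *v a"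
    define rb where "rb = gradient f (x + b) - gradient f x - A *v b"
    have zu: "z * norm u \<le> h * norm u" using z by (intro mult_right_mono) auto
    have "norm a \<le> h * norm v + z * norm u"
      unfolding a_def using z h by (intro order_trans[OF norm_triangle_ineq]) simp
    with zu have na: "norm a \<le> h * K" by (simp add: K_def algebra_simps)
    have nb: "norm b \<le> h * norm u" using z zu by (simp add: b_def)
    have "h * norm u \<le> h * K" using h(1) by (simp add: K_def)
    have hK: "h * K < d0"
    proof -
      have "h * K \<le> h * (K + 1)" using h(1) by simp
      also have "\<dots> < d0" using h K by (simp add: d_def field_simps)
      finally show ?thesis .
    qed
    have "norm ra \<le> e * norm a"
      unfolding ra_def using d0(2)[of "x + a"] na hK by simp
    also have "\<dots> \<le> e * (h * K)" using na e by simp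
    finally have ra: "norm ra \<le> e * (h * K)" .
    have "norm rb \<le> e * norm b"
      unfolding rb_def using d0(2)[of "x + b"] nb hK \<open>h * norm u \<le> h * K\<close> by simp
    also have "\<dots> \<le> e * (h * norm u)" using nb e by simp
    finally have rb: "norm rb \<le> e * (h * norm u)" .
    have "gradient f (x + a) - gradient f (x + b) = h *\<^sub>R (A *v v) + (ra - rb)"
      by (simp add: ra_def rb_def a_def b_def matrix_vector_right_distrib matrix_vector_mult_scaleR)
    then have "p h - p 0 = h * ((h *\<^sub>R (A *v v) + (ra - rb)) \<bullet> u)"
      by (metis pz a_def b_def add.assoc diff_zero inner_diff_left)
    then have "p h - p 0 - h\<^sup>2 * (u \<bullet> (A *v v)) = h * ((ra - rb) \<bullet> u)"
      by (simp add: inner_add_left power2_eq_square inner_commute algebra_simps)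
    moreover have "\<bar>(ra - rb) \<bullet> u\<bar> \<le> (e * (h * K) + e * (h * norm u)) * norm u"
      using Cauchy_Schwarz_ineq2[of "ra - rb" u] norm_triangle_ineq4[of ra rb] ra rb
      by (meson add_mono mult_right_mono norm_ge_zero order_trans)
    then have "h * \<bar>(ra - rb) \<bullet> u\<bar> \<le> h * ((e * (h * K) + e * (h * norm u)) * norm u)"
      using h(1) by (intro mult_left_mono) auto
    moreover have "h * ((e * (h * K) + e * (h * norm u)) * norm u) =
        e * h\<^sup>2 * (norm u * (2 * norm u + norm v))"
      by (simp add: K_def power2_eq_square algebra_simps)
    ultimately have "\<bar>p h - p 0 - h\<^sup>2 * (u \<bullet> (A *v v))\<bar> \<le> e * h\<^sup>2 * (norm u * (2 * norm u + norm v))"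
      using h(1) by (simp add: abs_mult)
    moreover have "p h - p 0 = f (x + h *\<^sub>R u + h *\<^sub>R v) - f (x + h *\<^sub>R u) - f (x + h *\<^sub>R v) + f x"
      by (simp add: p_def add.commute add.left_commute)
    ultimately show ?thesis by simp
  qed
  with d show thesis by (intro that) (auto simp: A_def)
qed

text \<open>
  The second difference is symmetric in the two directions \<open>u\<close> and \<open>v\<close>, and divided by \<open>h\<^sup>2\<close> it is close
  to both values of the bilinear form.
\<close>

theorem hessian_symmetric:
  fixes f :: "real ^ 'n \<Rightarrow> real"
  assumes f: "twice_differentiable f"
  shows "transpose (hessian f x) = hessian f x"
proof -
  have sym: "u \<bullet> (hessian f x *v v) = v \<bullet> (hessian f x *v u)" (is "?a = ?b") for u v
  proof -
    define K where "K = norm u * (2 * norm u + norm v) + norm v * (2 * norm v + norm u)"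
    have "\<bar>?a - ?b\<bar> \<le> e * K" if e: "e > 0" for e
    proof -
      obtain d1 where d1: "d1 > 0" "\<And>h. 0 < h \<Longrightarrow> h < d1 \<Longrightarrow>
        \<bar>f (x + h *\<^sub>R u + h *\<^sub>R v) - f (x + h *\<^sub>R u) - f (x + h *\<^sub>R v) + f x
          - h\<^sup>2 * ?a\<bar> \<le> e * h\<^sup>2 * (norm u * (2 * norm u + norm v))"
        using second_difference_estimate[OF f e] by blast
      obtain d2 where d2: "d2 > 0" "\<And>h. 0 < h \<Longrightarrow> h < d2 \<Longrightarrow>
        \<bar>f (x + h *\<^sub>R v + h *\<^sub>R u) - f (x + h *\<^sub>R v) - f (x + h *\<^sub>R u) + f x
          - h\<^sup>2 * ?b\<bar> \<le> e * h\<^sup>2 * (norm v * (2 * norm v + norm u))"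
        using second_difference_estimate[OF f e] by blast
      define h where "h = min d1 d2 / 2"
      have h: "0 < h" "h < d1" "h < d2" using d1(1) d2(1) by (auto simp: h_def min_def)
      have "x + h *\<^sub>R v + h *\<^sub>R u = x + h *\<^sub>R u + h *\<^sub>R v" by simp
      with d1(2)[OF h(1,2)] d2(2)[OF h(1,3)]
      have "\<bar>h\<^sup>2 * ?a - h\<^sup>2 * ?b\<bar> \<le> e * h\<^sup>2 * (norm u * (2 * norm u + norm v)) +
          e * h\<^sup>2 * (norm v * (2 * norm v + norm u))"
        by simp
      also have "\<dots> = h\<^sup>2 * (e * K)" by (simp add: K_def algebra_simps)
      also have "\<bar>h\<^sup>2 * ?a - h\<^sup>2 * ?b\<bar> = h\<^sup>2 * \<bar>?a - ?b\<bar>"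
        by (simp add: abs_mult flip: right_diff_distrib)
      finally show ?thesis using h(1) by simp
    qed
    then have "\<bar>?a - ?b\<bar> * inverse (K + 1) \<le> e" if "e > 0" for e
    proof -
      have K: "K \<ge> 0" by (simp add: K_def)
      from \<open>\<And>e. e > 0 \<Longrightarrow> \<bar>?a - ?b\<bar> \<le> e * K\<close>[OF that] have "\<bar>?a - ?b\<bar> \<le> e * (K + 1)"
        using that by (simp add: algebra_simps)
      then show ?thesis using K by (simp add: field_simps)
    qed
    then have "\<bar>?a - ?b\<bar> * inverse (K + 1) \<le> 0" by (rule field_le_epsilon[of _ 0, simplified])
    moreover have "inverse (K + 1) > 0" by (simp add: K_def add_nonneg_pos)
    ultimately show ?thesis by (simp add: mult_le_0_iff)
  qed
  have "transpose (hessian f x) *v u = hessian f x *v u" for u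
  proof -
    have "(transpose (hessian f x) *v u) \<bullet> v = (hessian f x *v u) \<bullet> v" for v
      using sym[of u v] by (metis inner_matrix_vector_transpose inner_commute)
    then show ?thesis by (metis vector_eq_rdot)
  qed
  then show ?thesis by (simp add: matrix_eq)
qed

text \<open>
  The form \<open>K + r k\<close> of the bound leaves room for the term of second order in the definition of strong
  convexity.
\<close>

lemma DERIV_le_if_difference_quotient_le:
  fixes p :: "real \<Rightarrow> real"
  assumes D: "(p has_real_derivative D) (at 0)"
    and le: "\<And>r. 0 < r \<Longrightarrow> r < 1 \<Longrightarrow> p r - p 0 \<le> r * (K + r * k)"
  shows "D \<le> K"
proof -
  have "((\<lambda>r. (p r - p 0) / r) \<longlongrightarrow> D) (at_right 0)"
    using D unfolding DERIV_def by (simp add: filterlim_at_split)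
  moreover have "((\<lambda>r. K + r * k) \<longlongrightarrow> K + 0 * k) (at_right 0)" by (intro tendsto_intros)
  moreover have "eventually (\<lambda>r. (p r - p 0) / r \<le> K + r * k) (at_right 0)"
    using le by (auto simp: eventually_at_right[of 0 1] field_simps intro!: exI[of _ 1])
  ultimately show ?thesis
    using tendsto_le[of "at_right (0::real)" "\<lambda>r. K + r * k" "K + 0 * k" "\<lambda>r. (p r - p 0) / r" D]
    by simp
qed

section \<open>Strong convexity and smoothness in a metric\<close>

lemma strongly_convex_first_order:
  fixes f :: "real ^ 'n \<Rightarrow> real"
  assumes f: "twice_differentiable f" and sc: "strongly_convex_on \<mu> UNIV f"
  shows "f y \<ge> f x + gradient f x \<bullet> (y - x) + \<mu> / 2 * (norm (y - x))\<^sup>2"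
proof -
  define n where "n = (norm (y - x))\<^sup>2"
  have n: "(norm (x - y))\<^sup>2 = n" by (simp add: n_def norm_minus_commute)
  have "gradient f x \<bullet> (y - x) \<le> f y - f x - \<mu> / 2 * n"
  proof (rule DERIV_le_if_difference_quotient_le)
    show "((\<lambda>r. f (x + r *\<^sub>R (y - x))) has_real_derivative gradient f x \<bullet> (y - x)) (at 0)"
      using DERIV_along_line[OF f, of x "y - x" 0] by simp
    fix r :: real assume r: "0 < r" "r < 1"
    have "f ((1 - r) *\<^sub>R x + r *\<^sub>R y) \<le> (1 - r) * f x + r * f y - \<mu> / 2 * (1 - r) * r * n"
      using sc r unfolding strongly_convex_on_def n[symmetric] by simp
    moreover have "(1 - r) *\<^sub>R x + r *\<^sub>R y = x + r *\<^sub>R (y - x)" by (simp add: algebra_simps)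
    ultimately show "f (x + r *\<^sub>R (y - x)) - f (x + 0 *\<^sub>R (y - x)) \<le>
        r * (f y - f x - \<mu> / 2 * n + r * (\<mu> / 2 * n))"
      by (simp add: field_simps)
  qed
  then show ?thesis by (simp add: n_def)
qed

lemma strongly_convex_gradient_monotone:
  fixes f :: "real ^ 'n \<Rightarrow> real"
  assumes "twice_differentiable f" "strongly_convex_on \<mu> UNIV f"
  shows "(y - x) \<bullet> (gradient f y - gradient f x) \<ge> \<mu> * (norm (y - x))\<^sup>2"
  using strongly_convex_first_order[OF assms, of x y] strongly_convex_first_order[OF assms, of y x]
  by (simp add: norm_minus_commute inner_diff_left inner_diff_right inner_commute)

lemma strongly_convex_hessian_lower_bound:
  fixes f :: "real ^ 'n \<Rightarrow> real"
  assumes f: "twice_differentiable f" and sc: "strongly_convex_on \<mu> UNIV f"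
  shows "v \<bullet> (hessian f x *v v) \<ge> \<mu> * (norm v)\<^sup>2"
proof -
  have "- (v \<bullet> (hessian f x *v v)) \<le> - (\<mu> * (norm v)\<^sup>2)"
  proof (rule DERIV_le_if_difference_quotient_le)
    show "((\<lambda>r. - (v \<bullet> gradient f (x + r *\<^sub>R v))) has_real_derivative
        - (v \<bullet> (hessian f x *v v))) (at 0)"
      using DERIV_minus[OF DERIV_gradient_along_line[OF f, of v x v 0]] by simp
    fix r :: real assume r: "0 < r" "r < 1"
    have "\<mu> * (r\<^sup>2 * (norm v)\<^sup>2) \<le> r * (v \<bullet> (gradient f (x + r *\<^sub>R v) - gradient f x))"
      using strongly_convex_gradient_monotone[OF f sc, of x "x + r *\<^sub>R v"] r
      by (simp add: power_mult_distrib inner_diff_right algebra_simps)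
    then have "r * (\<mu> * (r * (norm v)\<^sup>2)) \<le> r * (v \<bullet> (gradient f (x + r *\<^sub>R v) - gradient f x))"
      by (simp add: power2_eq_square mult_ac)
    then have "\<mu> * (r * (norm v)\<^sup>2) \<le> v \<bullet> (gradient f (x + r *\<^sub>R v) - gradient f x)"
      using r(1) by simp
    then show "- (v \<bullet> gradient f (x + r *\<^sub>R v)) - - (v \<bullet> gradient f (x + 0 *\<^sub>R v)) \<le>
        r * (- (\<mu> * (norm v)\<^sup>2) + r * 0)"
      by (simp add: inner_diff_right algebra_simps)
  qed
  then show ?thesis by simp
qed

lemma lipschitz_gradient_hessian_upper_bound:
  fixes f :: "real ^ 'n \<Rightarrow> real"
  assumes f: "twice_differentiable f" and lip: "L-lipschitz_on UNIV (gradient f)"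
  shows "v \<bullet> (hessian f x *v v) \<le> L * (norm v)\<^sup>2"
proof (rule DERIV_le_if_difference_quotient_le)
  show "((\<lambda>r. v \<bullet> gradient f (x + r *\<^sub>R v)) has_real_derivative v \<bullet> (hessian f x *v v)) (at 0)"
    using DERIV_gradient_along_line[OF f, of v x v 0] by simp
  fix r :: real assume r: "0 < r" "r < 1"
  have "v \<bullet> (gradient f (x + r *\<^sub>R v) - gradient f x) \<le>
      norm v * norm (gradient f (x + r *\<^sub>R v) - gradient f x)"
    by (rule norm_cauchy_schwarz)
  also have "\<dots> \<le> norm v * (L * (r * norm v))"
    using lipschitz_onD[OF lip, of "x + r *\<^sub>R v" x] r
    by (intro mult_left_mono) (simp_all add: dist_norm)
  finally show "v \<bullet> gradient f (x + r *\<^sub>R v) - v \<bullet> gradient f (x + 0 *\<^sub>R v) \<le>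
      r * (L * (norm v)\<^sup>2 + r * 0)"
    by (simp add: inner_diff_right power2_eq_square mult_ac)
qed

lemma strongly_convex_growth:
  fixes f :: "real ^ 'n \<Rightarrow> real"
  assumes f: "twice_differentiable f" and sc: "strongly_convex_on \<mu> UNIV f"
    and min: "\<And>z. f xstar \<le> f z"
  shows "f x - f xstar \<ge> \<mu> / 2 * (norm (x - xstar))\<^sup>2"
proof -
  have "gradient f xstar \<bullet> w = 0" for w
    using DERIV_along_line[OF f, of xstar w 0] min
    by (intro DERIV_local_min[of "\<lambda>r. f (xstar + r *\<^sub>R w)" _ 0 1]) auto
  then show ?thesis using strongly_convex_first_order[OF f sc, of xstar x] by simp
qed

text \<open>
  A Polyak-Lojasiewicz inequality in the metric of \<open>R\<close>. Lower curvature \<open>c\<close> along the segment gives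
  \<open>f (x + s) \<ge> f x + s \<bullet> g + c \<parallel>S s\<parallel>\<^sup>2 / 2\<close>, and minimizing the right-hand side over all \<open>s\<close> (here:
  completing the square) bounds \<open>f x - f (x + s)\<close>. Curvature is needed on one segment only, in
  the single direction \<open>s\<close>.
\<close>

lemma gradient_domination:
  fixes f :: "real ^ 'n \<Rightarrow> real" and R S :: "real ^ 'n ^ 'n"
  assumes f: "twice_differentiable f"
    and R: "transpose R = R" and RS: "R ** S = mat 1"
    and c: "c > 0"
    and low: "\<And>r. 0 \<le> r \<Longrightarrow> r \<le> 1 \<Longrightarrow> c * (norm (S *v s))\<^sup>2 \<le> s \<bullet> (hessian f (x + r *\<^sub>R s) *v s)"
  shows "2 * c * (f x - f (x + s)) \<le> (norm (R *v gradient f x))\<^sup>2"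
proof -
  define n where "n = (norm (S *v s))\<^sup>2"
  have grad: "s \<bullet> gradient f x + c * n * r \<le> s \<bullet> gradient f (x + r *\<^sub>R s)"
    if r: "0 \<le> r" "r \<le> 1" for r
  proof -
    define p where "p r = s \<bullet> gradient f (x + r *\<^sub>R s) - c * n * r" for r
    have "p 0 \<le> p r"
    proof (rule DERIV_nonneg_imp_nondecreasing[OF r(1)])
      fix z assume z: "0 \<le> z" "z \<le> r"
      have "(p has_real_derivative s \<bullet> (hessian f (x + z *\<^sub>R s) *v s) - c * n) (at z)"
        unfolding p_def
        by (auto intro!: derivative_eq_intros DERIV_gradient_along_line[OF f])
      moreover have "s \<bullet> (hessian f (x + z *\<^sub>R s) *v s) - c * n \<ge> 0"
        using low[of z] z r by (simp add: n_def)
      ultimately show "\<exists>y. (p has_real_derivative y) (at z) \<and> 0 \<le> y" by blast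
    qed
    then show ?thesis by (simp add: p_def)
  qed
  define q where "q r = f (x + r *\<^sub>R s) - r * (s \<bullet> gradient f x) - c * n * r\<^sup>2 / 2" for r
  have "q 0 \<le> q 1"
  proof (rule DERIV_nonneg_imp_nondecreasing[of 0 1 q])
    fix z :: real assume z: "0 \<le> z" "z \<le> 1"
    have "(q has_real_derivative gradient f (x + z *\<^sub>R s) \<bullet> s - s \<bullet> gradient f x - c * n * z) (at z)"
      unfolding q_def by (auto intro!: derivative_eq_intros DERIV_along_line[OF f])
    moreover have "gradient f (x + z *\<^sub>R s) \<bullet> s - s \<bullet> gradient f x - c * n * z \<ge> 0"
      using grad[OF z] by (simp add: inner_commute)
    ultimately show "\<exists>y. (q has_real_derivative y) (at z) \<and> 0 \<le> y" by blast
  qed simp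
  then have "f x - f (x + s) \<le> - (s \<bullet> gradient f x) - c * n / 2" by (simp add: q_def)
  then have "2 * c * (f x - f (x + s)) \<le> 2 * c * (- (s \<bullet> gradient f x) - c * n / 2)"
    using c by simp
  also have "\<dots> = (norm (R *v gradient f x))\<^sup>2 - (norm (R *v gradient f x + c *\<^sub>R (S *v s)))\<^sup>2"
  proof -
    have "(norm (R *v gradient f x + c *\<^sub>R (S *v s)))\<^sup>2 =
        (norm (R *v gradient f x))\<^sup>2 + 2 * c * (s \<bullet> gradient f x) + c\<^sup>2 * n"
      using inner_inverse_pair[OF R RS, of s "gradient f x"]
        inner_commute[of "R *v gradient f x" "S *v s"]
      by (simp add: power2_norm_eq_inner n_def inner_add_left inner_add_right
          power2_eq_square[of c] distrib_left)
    then show ?thesis by (simp add: power2_eq_square[of c] algebra_simps)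
  qed
  also have "\<dots> \<le> (norm (R *v gradient f x))\<^sup>2" by simp
  finally show ?thesis .
qed

text \<open>
  The secant pair satisfies the inequality that \<open>y = A s\<close> with \<open>0 \<le> A \<le> K R\<^sup>-\<^sup>2\<close> would give, where
  \<open>A\<close> is the Hessian averaged over the segment. The average is avoided by testing the gradient with
  \<open>w = R\<^sup>2 y\<close> and using \<open>2 K (w \<bullet> H s) \<le> w \<bullet> H w + K\<^sup>2 (s \<bullet> H s)\<close>, a form of the Cauchy-Schwarz
  inequality: the first term on the right is at most \<open>K \<parallel>R y\<parallel>\<^sup>2\<close>, and the second one is again a
  derivative along the segment.
\<close>

lemma secant_cocoercive:
  fixes f :: "real ^ 'n \<Rightarrow> real" and R S :: "real ^ 'n ^ 'n"
  assumes f: "twice_differentiable f"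
    and R: "transpose R = R" and SR: "S ** R = mat 1"
    and K: "K > 0"
    and psd: "\<And>r v. 0 \<le> r \<Longrightarrow> r \<le> 1 \<Longrightarrow> 0 \<le> v \<bullet> (hessian f (x + r *\<^sub>R s) *v v)"
    and up: "\<And>r v. 0 \<le> r \<Longrightarrow> r \<le> 1 \<Longrightarrow>
      v \<bullet> (hessian f (x + r *\<^sub>R s) *v v) \<le> K * (norm (S *v v))\<^sup>2"
  shows "(norm (R *v (gradient f (x + s) - gradient f x)))\<^sup>2 \<le>
    K * (s \<bullet> (gradient f (x + s) - gradient f x))"
proof -
  define y where "y = gradient f (x + s) - gradient f x"
  define n where "n = (norm (R *v y))\<^sup>2"
  define w where "w = R *v (R *v y)"
  have "S *v w = R *v y"
    by (metis w_def SR matrix_vector_mul_assoc matrix_vector_mul_lid)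
  then have Sw: "(norm (S *v w))\<^sup>2 = n" by (simp add: n_def)
  have wy: "w \<bullet> y = n"
    unfolding w_def n_def power2_norm_eq_inner by (metis R inner_commute inner_matrix_vector_transpose)
  define p where "p r = w \<bullet> gradient f (x + r *\<^sub>R s) - K / 2 * (s \<bullet> gradient f (x + r *\<^sub>R s)) - n / 2 * r"
    for r
  have "p 1 \<le> p 0"
  proof (rule DERIV_nonpos_imp_nonincreasing[of 0 1 p])
    fix r :: real assume r: "0 \<le> r" "r \<le> 1"
    define A where "A = hessian f (x + r *\<^sub>R s)"
    have "(p has_real_derivative w \<bullet> (A *v s) - K / 2 * (s \<bullet> (A *v s)) - n / 2) (at r)"
      unfolding p_def A_def
      by (auto intro!: derivative_eq_intros DERIV_gradient_along_line[OF f])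
    moreover have "w \<bullet> (A *v s) - K / 2 * (s \<bullet> (A *v s)) - n / 2 \<le> 0"
    proof -
      have sw: "s \<bullet> (A *v w) = w \<bullet> (A *v s)"
        unfolding A_def by (metis hessian_symmetric[OF f] inner_commute inner_matrix_vector_transpose)
      have "0 \<le> (w - K *\<^sub>R s) \<bullet> (A *v (w - K *\<^sub>R s))" unfolding A_def by (rule psd[OF r])
      also have "\<dots> = w \<bullet> (A *v w) - 2 * K * (w \<bullet> (A *v s)) + K * K * (s \<bullet> (A *v s))"
        by (simp add: matrix_vector_mult_diff_distrib matrix_vector_mult_scaleR inner_diff_left
            inner_diff_right sw algebra_simps)
      also have "w \<bullet> (A *v w) \<le> K * n" using up[OF r, of w] by (simp add: A_def Sw)
      finally have "0 \<le> K * (n - 2 * (w \<bullet> (A *v s)) + K * (s \<bullet> (A *v s)))"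
        by (simp add: algebra_simps)
      then show ?thesis using K by (simp add: zero_le_mult_iff)
    qed
    ultimately show "\<exists>y. (p has_real_derivative y) (at r) \<and> y \<le> 0" by blast
  qed simp
  then have "w \<bullet> y - K / 2 * (s \<bullet> y) - n / 2 \<le> 0"
    by (simp add: p_def y_def inner_diff_right algebra_simps)
  then show ?thesis unfolding y_def[symmetric] n_def[symmetric] using wy by simp
qed

lemma lipschitz_hessian_form:
  fixes f :: "real ^ 'n \<Rightarrow> real"
  assumes "\<And>u v. spectral_norm (hessian f u - hessian f v) \<le> M * norm (u - v)"
  shows "\<bar>v \<bullet> (hessian f x *v v) - v \<bullet> (hessian f z *v v)\<bar> \<le> M * norm (x - z) * (norm v)\<^sup>2"
proof -
  define D where "D = hessian f x - hessian f z"
  have "\<bar>v \<bullet> (D *v v)\<bar> \<le> norm v * norm (D *v v)" by (rule Cauchy_Schwarz_ineq2)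
  also have "\<dots> \<le> norm v * (spectral_norm D * norm v)"
    unfolding spectral_norm_def
    by (intro mult_left_mono onorm linear_linear[THEN iffD1])
      (simp_all add: linear_conv_bounded_linear[symmetric])
  also have "\<dots> \<le> norm v * ((M * norm (x - z)) * norm v)"
    unfolding D_def using assms by (intro mult_left_mono mult_right_mono) auto
  finally show ?thesis
    by (simp add: D_def matrix_vector_mult_diff_rdistrib inner_diff_right power2_eq_square mult_ac)
qed

section \<open>From a potential to a linear rate\<close>

text \<open>
  The graph of the concave function \<open>u \<mapsto> ln (1 - exp u)\<close> lies below its tangent at \<open>u = ln a\<close>.
\<close>

lemma tangent_bound_ln_one_minus:
  fixes a p :: real
  assumes a: "0 < a" "a < 1" and p: "0 < p" "p < 1"
  shows "ln (1 - p) \<le> ln (1 - a) - a / (1 - a) * (ln p - ln a)"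
proof -
  have "ln (1 - p) - ln (1 - a) \<le> (1 - p) / (1 - a) - 1"
    using ln_le_minus_one[of "(1 - p) / (1 - a)"] a p by (simp add: ln_div)
  also have "\<dots> = a / (1 - a) * (1 - p / a)" using a by (simp add: field_simps)
  also have "\<dots> \<le> a / (1 - a) * (- (ln p - ln a))"
    using ln_le_minus_one[of "p / a"] a p by (intro mult_left_mono) (simp_all add: ln_div)
  finally show ?thesis unfolding mult_minus_right by linarith
qed

text \<open>
  The step condition bounds \<open>\<Sum> ln p\<^sub>i\<close> from below, where \<open>p\<^sub>i = 1 - h\<^sub>i\<^sub>+\<^sub>1 / h\<^sub>i\<close> is the relative
  decrease: \<open>P\<close> telescopes, and by the budget everything lost is at most 1 per iteration on
  average, which the factor \<open>3 \<ge> exp 1\<close> absorbs. Hence the geometric mean of the \<open>p\<^sub>i\<close> is at least \<open>a\<close>, and by the tangent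
  bound the \<open>p\<^sub>i\<close> are no worse than if all of them were equal to \<open>a\<close>.
\<close>

lemma linear_rate_from_potential:
  fixes h P d :: "nat \<Rightarrow> real"
  assumes a: "0 < a" "a < 1" and h: "\<And>i. h i > 0"
    and dec: "\<And>i. i < t \<Longrightarrow> h (Suc i) < h i"
    and step: "\<And>i. i < t \<Longrightarrow> ln (3 * a) + P (Suc i) - P i - d i \<le> ln (1 - h (Suc i) / h i)"
    and P: "P t \<ge> 0" and budget: "P 0 + (\<Sum>i<t. d i) \<le> t"
  shows "h t \<le> (1 - a) ^ t * h 0"
proof -
  define l where "l i = ln (1 - h (Suc i) / h i)" for i
  define c where "c = a / (1 - a)"
  have "ln (3::real) \<ge> 1"
    using exp_le by (subst ln_ge_iff) simp_all
  then have "t * ln a \<le> t * (ln (3 * a) - 1)"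
    using a by (intro mult_left_mono) (simp_all add: ln_mult)
  also have "\<dots> \<le> t * ln (3 * a) + (P t - P 0) - (\<Sum>i<t. d i)"
    using P budget by (simp add: algebra_simps)
  also have "\<dots> = (\<Sum>i<t. ln (3 * a) + (P (Suc i) - P i) - d i)"
    using sum_lessThan_telescope[of P t] by (simp add: sum.distrib sum_subtractf)
  also have "\<dots> \<le> (\<Sum>i<t. l i)"
    using step by (intro sum_mono) (simp add: l_def algebra_simps)
  finally have l: "t * ln a \<le> (\<Sum>i<t. l i)" .
  have "ln (h t) - ln (h 0) = (\<Sum>i<t. ln (h (Suc i)) - ln (h i))"
    by (simp add: sum_lessThan_telescope[of "\<lambda>i. ln (h i)"])
  also have "\<dots> \<le> (\<Sum>i<t. ln (1 - a) - c * (l i - ln a))"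
  proof (intro sum_mono)
    fix i assume "i \<in> {..<t}"
    then have "h (Suc i) < h i" using dec by simp
    then show "ln (h (Suc i)) - ln (h i) \<le> ln (1 - a) - c * (l i - ln a)"
      using tangent_bound_ln_one_minus[OF a, of "1 - h (Suc i) / h i"] h[of i] h[of "Suc i"]
      by (simp add: l_def ln_div c_def)
  qed
  also have "\<dots> = t * ln (1 - a) - c * ((\<Sum>i<t. l i) - t * ln a)"
    by (simp add: sum_subtractf sum_distrib_left[symmetric])
  also have "\<dots> \<le> t * ln (1 - a)" using l a by (simp add: c_def)
  also have "\<dots> = ln ((1 - a) ^ t)" using a by (simp add: ln_realpow)
  finally have "ln (h t) \<le> ln ((1 - a) ^ t * h 0)"
    using a h[of 0] by (simp add: ln_mult_pos)
  then show ?thesis using a h[of 0] h[of t] by simp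
qed

section \<open>Quasi-Newton steps with an Armijo-Wolfe step size\<close>

lemma spd_matrix_inv:
  assumes "spd B"
  shows "B ** matrix_inv B = mat 1" "matrix_inv B ** B = mat 1"
  using spd_invertible[OF assms] someI_ex[of "\<lambda>C. B ** C = mat 1 \<and> C ** B = mat 1"]
  unfolding invertible_def matrix_inv_def by blast+

lemma armijo_wolfe_quasi_newton_step:
  fixes f :: "real ^ 'n \<Rightarrow> real" and B :: "real ^ 'n ^ 'n"
  assumes B: "spd B" and g: "gradient f x \<noteq> 0" and e: "e > 0"
    and aw: "armijo_wolfe f \<alpha> \<beta> x (bfgs_direction f x B) e"
    and s: "s = e *\<^sub>R bfgs_direction f x B"
    and y: "y = gradient f (x + s) - gradient f x"
  shows "B *v s = - (e *\<^sub>R gradient f x)" and "s \<bullet> (B *v s) > 0"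
    and "(1 - \<beta>) * (s \<bullet> (B *v s)) \<le> e * (s \<bullet> y)"
    and "\<alpha> * (s \<bullet> (B *v s)) \<le> e * (f x - f (x + s))"
proof -
  define p where "p = bfgs_direction f x B"
  have Bp: "B *v p = - gradient f x"
    unfolding p_def bfgs_direction_def
    by (simp add: linear_neg matrix_vector_mul_assoc spd_matrix_inv[OF B])
  have sp: "s = e *\<^sub>R p" by (simp add: s p_def)
  show Bs: "B *v s = - (e *\<^sub>R gradient f x)" by (simp add: sp matrix_vector_mult_scaleR Bp)
  have "p \<noteq> 0" using Bp g by auto
  then show "s \<bullet> (B *v s) > 0" using B e by (simp add: spd_def sp matrix_vector_mult_scaleR)
  have sBs: "s \<bullet> (B *v s) = e * (e * (- (gradient f x \<bullet> p)))"
    unfolding Bs by (simp add: sp inner_commute)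
  have "- (gradient f x \<bullet> p) * (1 - \<beta>) \<le> y \<bullet> p"
    using aw unfolding armijo_wolfe_def p_def[symmetric] y sp[symmetric]
    by (simp add: inner_diff_left algebra_simps)
  then have "e * (e * (- (gradient f x \<bullet> p) * (1 - \<beta>))) \<le> e * (e * (y \<bullet> p))"
    using e by (intro mult_left_mono) simp_all
  then show "(1 - \<beta>) * (s \<bullet> (B *v s)) \<le> e * (s \<bullet> y)"
    unfolding sBs by (simp add: sp inner_commute algebra_simps)
  have "\<alpha> * e * (- (gradient f x \<bullet> p)) \<le> f x - f (x + s)"
    using aw unfolding armijo_wolfe_def p_def[symmetric] sp[symmetric] by simp
  then have "e * (\<alpha> * e * (- (gradient f x \<bullet> p))) \<le> e * (f x - f (x + s))"
    using e by (intro mult_left_mono) simp_all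
  then show "\<alpha> * (s \<bullet> (B *v s)) \<le> e * (f x - f (x + s))"
    unfolding sBs by (simp add: algebra_simps)
qed

text \<open>
  Let \<open>D = - (g \<bullet> s)\<close>. The Armijo condition gives a decrease of at least \<open>\<alpha> D\<close>, the Wolfe condition
  gives \<open>(1 - \<beta>) D \<le> s \<bullet> y\<close>, and the gradient bound gives \<open>2 c / \<parallel>R g\<parallel>\<^sup>2 \<le> 1 / (f x - m)\<close>. As
  \<open>B s\<close> is a multiple of \<open>g\<close>, the left-hand side is \<open>2 \<alpha> (1 - \<beta>) c D\<^sup>2 / (\<parallel>R g\<parallel>\<^sup>2 (s \<bullet> y))\<close>.
\<close>

lemma relative_decrease_lower_bound:
  fixes f :: "real ^ 'n \<Rightarrow> real" and B R :: "real ^ 'n ^ 'n"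
  assumes B: "spd B" and g: "gradient f x \<noteq> 0" and e: "e > 0"
    and aw: "armijo_wolfe f \<alpha> \<beta> x (bfgs_direction f x B) e"
    and s: "s = e *\<^sub>R bfgs_direction f x B"
    and y: "y = gradient f (x + s) - gradient f x"
    and \<alpha>: "\<alpha> > 0" and \<beta>: "\<beta> < 1" and c: "c > 0" and h: "f x > m"
    and dom: "2 * c * (f x - m) \<le> (norm (R *v gradient f x))\<^sup>2"
  shows "2 * \<alpha> * (1 - \<beta>) * c * ((s \<bullet> (B *v s))\<^sup>2 / ((norm (R *v (B *v s)))\<^sup>2 * (s \<bullet> y)))
    \<le> 1 - (f (x + s) - m) / (f x - m)"
proof -
  note st = armijo_wolfe_quasi_newton_step[OF B g e aw s y]
  define a where "a = s \<bullet> (B *v s)"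
  define b where "b = s \<bullet> y"
  define N where "N = (norm (R *v gradient f x))\<^sup>2"
  define H where "H = f x - m"
  have a: "a > 0" using st(2) by (simp add: a_def)
  have eb: "(1 - \<beta>) * a \<le> e * b" using st(3) by (simp add: a_def b_def)
  moreover have "(1 - \<beta>) * a > 0" using a \<beta> by simp
  ultimately have "e * b > 0" by linarith
  then have b: "b > 0" using e by (simp add: zero_less_mult_iff)
  have H: "H > 0" using h by (simp add: H_def)
  have N: "2 * c * H \<le> N" using dom by (simp add: N_def H_def)
  moreover have "2 * c * H > 0" using c H by simp
  ultimately have N0: "N > 0" by linarith
  have RBs: "(norm (R *v (B *v s)))\<^sup>2 = e\<^sup>2 * N"
    unfolding st(1) N_def using e
    by (simp add: linear_neg matrix_vector_mult_scaleR power_mult_distrib)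
  have "2 * \<alpha> * (1 - \<beta>) * c * (a\<^sup>2 / (e\<^sup>2 * N * b)) =
      2 * \<alpha> * c / N * (a / e) * ((1 - \<beta>) * a / (e * b))"
    using e b N0 by (simp add: power2_eq_square field_simps)
  also have "\<dots> \<le> 2 * \<alpha> * c / N * (a / e) * 1"
    using \<alpha> c N0 a e eb \<open>e * b > 0\<close> by (intro mult_left_mono) simp_all
  also have "\<dots> = (\<alpha> * a / e) * (2 * c / N)" by (simp add: mult_ac)
  also have "\<dots> \<le> (\<alpha> * a / e) * (1 / H)"
    using N N0 H \<alpha> a e by (intro mult_left_mono) (simp_all add: field_simps)
  also have "\<dots> \<le> (f x - f (x + s)) * (1 / H)"
    using st(4) e H by (intro mult_right_mono) (simp_all add: a_def field_simps)
  also have "\<dots> = 1 - (f (x + s) - m) / H" using H by (simp add: field_simps H_def)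
  finally show ?thesis unfolding RBs a_def[symmetric] b_def[symmetric] H_def[symmetric] .
qed

lemma bfgs_sequenceD:
  assumes "bfgs_sequence f x B \<eta>"
  shows "gradient f (x i) \<noteq> 0" "\<eta> i > 0"
    "x (Suc i) = x i + \<eta> i *\<^sub>R bfgs_direction f (x i) (B i)"
    "B (Suc i) = bfgs_update (B i) (\<eta> i *\<^sub>R bfgs_direction f (x i) (B i))
      (gradient f (x i + \<eta> i *\<^sub>R bfgs_direction f (x i) (B i)) - gradient f (x i))"
  using assms unfolding bfgs_sequence_def by simp_all

text \<open>
  The Wolfe condition makes \<open>s \<bullet> y\<close> positive, and this is what keeps the matrices positive definite; the
  Armijo condition then gives descent.
\<close>

lemma bfgs_sequence_invariant:
  fixes f :: "real ^ 'n \<Rightarrow> real"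
  assumes seq: "bfgs_sequence f x B \<eta>" and B0: "spd (B 0)"
    and aw: "\<And>k. armijo_wolfe f \<alpha> \<beta> (x k) (bfgs_direction f (x k) (B k)) (\<eta> k)"
    and \<alpha>: "\<alpha> > 0" and \<beta>: "\<beta> < 1"
  shows "spd (B i)"
    and "(x (Suc i) - x i) \<bullet> (gradient f (x (Suc i)) - gradient f (x i)) > 0"
    and "f (x (Suc i)) < f (x i)"
proof -
  have step: "(x (Suc i) - x i) \<bullet> (gradient f (x (Suc i)) - gradient f (x i)) > 0 \<and>
      f (x (Suc i)) < f (x i)" if B: "spd (B i)" for i
  proof -
    note st = armijo_wolfe_quasi_newton_step[OF B bfgs_sequenceD(1,2)[OF seq] aw refl refl]
    let ?s = "\<eta> i *\<^sub>R bfgs_direction f (x i) (B i)"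
    have e: "\<eta> i > 0" by (rule bfgs_sequenceD(2)[OF seq])
    have "(1 - \<beta>) * (?s \<bullet> (B i *v ?s)) > 0" "\<alpha> * (?s \<bullet> (B i *v ?s)) > 0"
      using st(2) \<alpha> \<beta> by simp_all
    with st(3,4) have "\<eta> i * (?s \<bullet> (gradient f (x i + ?s) - gradient f (x i))) > 0"
      "\<eta> i * (f (x i) - f (x i + ?s)) > 0"
      by linarith+
    then show ?thesis using e bfgs_sequenceD(3)[OF seq, of i] by (simp add: zero_less_mult_iff)
  qed
  have spd: "spd (B i)" for i
  proof (induction i)
    case (Suc i)
    then show ?case
      using step[OF Suc] bfgs_sequenceD(3,4)[OF seq, of i] by (simp add: spd_bfgs_update)
  qed (rule B0)
  show "spd (B i)" by (rule spd)
  show "(x (Suc i) - x i) \<bullet> (gradient f (x (Suc i)) - gradient f (x i)) > 0"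
    "f (x (Suc i)) < f (x i)"
    using step[OF spd] by auto
qed

text \<open>
  The convergence result for an arbitrary metric. The errors \<open>\<epsilon>\<^sub>i\<close> (how far the secant pair is from
  satisfying \<open>\<parallel>R y\<parallel>\<^sup>2 \<le> s \<bullet> y\<close>) and \<open>\<delta>\<^sub>i\<close> (how far gradient domination with constant \<open>\<rho>\<close> fails, on a
  logarithmic scale) enter only through their sum, on the same footing as the initial potential.
\<close>

theorem bfgs_rate_in_metric:
  fixes f :: "real ^ 'n \<Rightarrow> real" and R S :: "real ^ 'n ^ 'n"
  assumes seq: "bfgs_sequence f x B \<eta>" and B0: "spd (B 0)"
    and aw: "\<And>k. armijo_wolfe f \<alpha> \<beta> (x k) (bfgs_direction f (x k) (B k)) (\<eta> k)"
    and \<alpha>: "0 < \<alpha>" "\<alpha> < 1 / 2" and \<beta>: "0 < \<beta>" "\<beta> < 1" and \<rho>: "0 < \<rho>" "\<rho> \<le> 1"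
    and min: "\<And>z. m \<le> f z"
    and R: "transpose R = R" and RS: "R ** S = mat 1"
    and curv: "\<And>i. (norm (R *v (gradient f (x (Suc i)) - gradient f (x i))))\<^sup>2 \<le>
      (1 + \<epsilon> i) * ((x (Suc i) - x i) \<bullet> (gradient f (x (Suc i)) - gradient f (x i)))"
    and dom: "\<And>i. 2 * (\<rho> * exp (- \<delta> i)) * (f (x i) - m) \<le> (norm (R *v gradient f (x i)))\<^sup>2"
    and budget: "Psi (R ** B 0 ** R) + (\<Sum>i<t. \<epsilon> i + \<delta> i) \<le> t"
  shows "f (x t) - m \<le> (1 - 2 * \<alpha> * (1 - \<beta>) * \<rho> / 3) ^ t * (f (x 0) - m)"
proof (rule linear_rate_from_potential[where P = "\<lambda>i. Psi (R ** B i ** R)"])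
  note inv = bfgs_sequence_invariant[OF seq B0 aw \<alpha>(1) \<beta>(2)]
  have pos: "f (x i) > m" for i using inv(3)[of i] min[of "x (Suc i)"] by linarith
  show "0 < 2 * \<alpha> * (1 - \<beta>) * \<rho> / 3" using \<alpha> \<beta> \<rho> by simp
  have "(2 * \<alpha>) * (1 - \<beta>) * \<rho> \<le> 1 * 1 * 1"
    using \<alpha> \<beta> \<rho> by (intro mult_mono) simp_all
  then show "2 * \<alpha> * (1 - \<beta>) * \<rho> / 3 < 1" by simp
  show "f (x i) - m > 0" for i using pos by simp
  show "f (x (Suc i)) - m < f (x i) - m" for i using inv(3) by simp
  have "invertible R"
    using RS matrix_left_right_inverse unfolding invertible_def by blast
  then have "spd (R ** B t ** transpose R)" by (rule spd_congruence[OF inv(1)])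
  then show "Psi (R ** B t ** R) \<ge> 0" by (simp add: R Psi_nonneg)
  show "Psi (R ** B 0 ** R) + (\<Sum>i<t. \<epsilon> i + \<delta> i) \<le> t" by (rule budget)
  fix i
  define s where "s = x (Suc i) - x i"
  define y where "y = gradient f (x (Suc i)) - gradient f (x i)"
  have sD: "s = \<eta> i *\<^sub>R bfgs_direction f (x i) (B i)" and xs: "x (Suc i) = x i + s"
    using bfgs_sequenceD(3)[OF seq, of i] by (simp_all add: s_def)
  have yD: "y = gradient f (x i + s) - gradient f (x i)" by (simp add: y_def xs)
  have BS: "B (Suc i) = bfgs_update (B i) s y"
    using bfgs_sequenceD(4)[OF seq, of i] by (simp add: sD yD)
  have sy: "s \<bullet> y > 0" using inv(2) by (simp add: s_def y_def)
  define w where "w = (s \<bullet> (B i *v s))\<^sup>2 / ((norm (R *v (B i *v s)))\<^sup>2 * (s \<bullet> y))"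
  define k where "k = 2 * \<alpha> * (1 - \<beta>) * \<rho>"
  have k: "k > 0" using \<alpha> \<beta> \<rho> by (simp add: k_def)
  have progress: "k * exp (- \<delta> i) * w \<le> 1 - (f (x (Suc i)) - m) / (f (x i) - m)"
    using relative_decrease_lower_bound[OF inv(1) bfgs_sequenceD(1,2)[OF seq] aw sD yD \<alpha>(1) \<beta>(2)
        _ pos dom] \<rho>
    by (simp add: xs w_def k_def mult_ac)
  have "(norm (R *v y))\<^sup>2 / (s \<bullet> y) \<le> 1 + \<epsilon> i"
    using curv[of i] sy by (simp add: s_def[symmetric] y_def[symmetric] field_simps)
  then have lnw: "Psi (R ** B (Suc i) ** R) - Psi (R ** B i ** R) - \<epsilon> i \<le> ln w"
    using Psi_decrease_lower_bounds_progress[OF inv(1)[of i] sy R RS] by (simp add: BS w_def)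
  have w: "w > 0"
  proof -
    note st = armijo_wolfe_quasi_newton_step[OF inv(1) bfgs_sequenceD(1,2)[OF seq] aw sD yD]
    have "(S *v s) \<bullet> (R *v (B i *v s)) = s \<bullet> (B i *v s)"
      by (rule inner_inverse_pair[OF R RS])
    with st(2) have "R *v (B i *v s) \<noteq> 0" by auto
    then show ?thesis using st(2) sy by (simp add: w_def)
  qed
  have "ln (k * exp (- \<delta> i) * w) = ln k - \<delta> i + ln w"
    using k w by (simp add: ln_mult_pos)
  moreover have "ln (k * exp (- \<delta> i) * w) \<le> ln (1 - (f (x (Suc i)) - m) / (f (x i) - m))"
    using progress k w by (intro ln_mono) simp_all
  moreover have "3 * (2 * \<alpha> * (1 - \<beta>) * \<rho> / 3) = k" by (simp add: k_def)
  ultimately show "ln (3 * (2 * \<alpha> * (1 - \<beta>) * \<rho> / 3)) + Psi (R ** B (Suc i) ** R) -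
      Psi (R ** B i ** R) - (\<epsilon> i + \<delta> i) \<le> ln (1 - (f (x (Suc i)) - m) / (f (x i) - m))"
    using lnw by simp
qed

section \<open>Two metrics\<close>

text \<open>
  Terms before \<open>T\<close> are bounded by the first one, later ones by a geometric series of ratio
  \<open>sqrt r\<close>, whose sum is at most \<open>2 / (1 - r)\<close>. There may be more than \<open>T\<close> indices below \<open>T\<close>, because
  of rounding; but the index 0 is paid for by the geometric series, and so rounding
  does not enter the bound.
\<close>

lemma sum_sqrt_eventually_geometric:
  fixes h :: "nat \<Rightarrow> real"
  assumes h: "\<And>i. 0 \<le> h i" "\<And>i. h i \<le> h 0" and r: "0 \<le> r" "r < 1" and T: "0 \<le> T"
    and geo: "\<And>i. T \<le> real i \<Longrightarrow> h i \<le> r ^ i * h 0"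
  shows "(\<Sum>i<t. sqrt (h i)) \<le> sqrt (h 0) * (T + 2 / (1 - r))"
proof -
  define q where "q = sqrt r"
  have q: "0 \<le> q" "q < 1" "q * q = r" using r by (simp_all add: q_def)
  define m where "m = nat \<lceil>T\<rceil>"
  have "sqrt (h i) \<le> sqrt (h 0) * ((if i \<in> {1..<m} then 1 else 0) + q ^ i)" for i
  proof (cases "i = 0 \<or> m \<le> i")
    case True
    have "h i \<le> r ^ i * h 0"
    proof (cases "i = 0")
      case False
      with True have "T \<le> real i" by (simp add: m_def)
      then show ?thesis by (rule geo)
    qed simp
    then have "sqrt (h i) \<le> sqrt (r ^ i * h 0)" by (rule real_sqrt_le_mono)
    also have "\<dots> = q ^ i * sqrt (h 0)" by (simp add: q_def real_sqrt_mult real_sqrt_power)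
    finally have "sqrt (h i) \<le> q ^ i * sqrt (h 0)" .
    then show ?thesis using True by (auto simp: mult.commute)
  next
    case False
    have "sqrt (h i) \<le> sqrt (h 0) * 1" using h(2) by simp
    also have "\<dots> \<le> sqrt (h 0) * (1 + q ^ i)" using h(1) q by (intro mult_left_mono) simp_all
    finally show ?thesis using False by simp
  qed
  then have "(\<Sum>i<t. sqrt (h i)) \<le>
      (\<Sum>i<t. sqrt (h 0) * ((if i \<in> {1..<m} then 1 else 0) + q ^ i))"
    by (intro sum_mono)
  also have "\<dots> = sqrt (h 0) * ((\<Sum>i<t. if i \<in> {1..<m} then 1 else 0) + (\<Sum>i<t. q ^ i))"
    by (simp add: sum_distrib_left[symmetric] sum.distrib del: atLeastLessThan_iff)
  also have "\<dots> \<le> sqrt (h 0) * (T + 2 / (1 - r))"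
  proof (intro mult_left_mono add_mono)
    have "(\<Sum>i<t. if i \<in> {1..<m} then 1 else (0::real)) = card ({..<t} \<inter> {1..<m})"
      by (subst sum.If_cases) (simp_all add: Int_def)
    also have "\<dots> \<le> card {1..<m}" by (intro of_nat_mono card_mono) auto
    also have "\<dots> \<le> T"
    proof (cases "m = 0")
      case False
      then show ?thesis using T by (simp add: m_def of_nat_diff) linarith
    qed (simp add: T)
    finally show "(\<Sum>i<t. if i \<in> {1..<m} then 1 else (0::real)) \<le> T" .
    have "(\<Sum>i<t. q ^ i) = (1 - q ^ t) / (1 - q)"
      using q by (simp add: sum_gp_strict)
    also have "\<dots> \<le> 1 / (1 - q)" using q by (intro divide_right_mono) simp_all
    also have "\<dots> \<le> 2 / (1 - r)"
    proof -
      have "1 - r = (1 - q) * (1 + q)" using q(3) by (simp add: algebra_simps)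
      also have "\<dots> \<le> (1 - q) * 2" using q by (intro mult_left_mono) simp_all
      finally show ?thesis using q r by (simp add: field_simps)
    qed
    finally show "(\<Sum>i<t. q ^ i) \<le> 2 / (1 - r)" .
  qed (use h in simp)
  finally show ?thesis .
qed

text \<open>
  An absolute perturbation of size \<open>\<mu> C\<close> of the Hessian is a relative one of size \<open>C\<close>, since all
  Hessians are bounded below by \<open>\<mu>\<close>.
\<close>

lemma relative_hessian_bounds:
  fixes f :: "real ^ 'n \<Rightarrow> real"
  assumes f: "twice_differentiable f" and sc: "strongly_convex_on \<mu> UNIV f"
    and \<mu>: "\<mu> > 0" and M: "M > 0"
    and lip: "\<And>u v. spectral_norm (hessian f u - hessian f v) \<le> M * norm (u - v)"
    and z: "M * norm (z - xstar) \<le> \<mu> * C"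
  shows "v \<bullet> (hessian f z *v v) \<le> (1 + C) * (v \<bullet> (hessian f xstar *v v))"
    and "v \<bullet> (hessian f xstar *v v) \<le> (1 + C) * (v \<bullet> (hessian f z *v v))"
proof -
  have "\<mu> * C \<ge> 0" using z M by (meson mult_nonneg_nonneg norm_ge_zero less_imp_le order_trans)
  then have C: "C \<ge> 0" using \<mu> by (simp add: zero_le_mult_iff)
  have diff: "\<bar>v \<bullet> (hessian f z *v v) - v \<bullet> (hessian f xstar *v v)\<bar> \<le> C * (\<mu> * (norm v)\<^sup>2)"
  proof -
    have "M * norm (z - xstar) * (norm v)\<^sup>2 \<le> \<mu> * C * (norm v)\<^sup>2"
      using z by (rule mult_right_mono) simp
    then show ?thesis
      using lipschitz_hessian_form[OF lip, of v z xstar] by (simp add: mult_ac)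
  qed
  have low: "C * (\<mu> * (norm v)\<^sup>2) \<le> C * (v \<bullet> (hessian f w *v v))" for w
    using strongly_convex_hessian_lower_bound[OF f sc] C by (rule mult_left_mono)
  show "v \<bullet> (hessian f z *v v) \<le> (1 + C) * (v \<bullet> (hessian f xstar *v v))"
    using diff low[of xstar] by (simp add: distrib_right)
  show "v \<bullet> (hessian f xstar *v v) \<le> (1 + C) * (v \<bullet> (hessian f z *v v))"
    using diff low[of z] by (simp add: distrib_right)
qed

theorem theorem5p2:
  fixes f :: "real ^ 'n \<Rightarrow> real"
    and \<mu> L M \<kappa> \<alpha> \<beta> :: real
    and xstar :: "real ^ 'n"
    and x :: "nat \<Rightarrow> real ^ 'n"
    and B :: "nat \<Rightarrow> real ^ 'n ^ 'n"
    and \<eta> :: "nat \<Rightarrow> real"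
    and t :: nat
  assumes "twice_differentiable f"
    and "\<mu> > 0" and "strongly_convex_on \<mu> UNIV f"
    and "L > 0" and "L-lipschitz_on UNIV (gradient f)"
    and "M > 0" and "\<And>u v. spectral_norm (hessian f u - hessian f v) \<le> M * norm (u - v)"
    and "\<kappa> = L / \<mu>"
    and "is_arg_min f (\<lambda>_. True) xstar"
    and "0 < \<alpha>" and "\<alpha> < \<beta>" and "\<beta> < 1" and "\<alpha> < 1 / 2"
    and "spd (B 0)"
    and "bfgs_sequence f x B \<eta>"
    and "\<And>k. armijo_wolfe f \<alpha> \<beta> (x k) (bfgs_direction f (x k) (B k)) (\<eta> k)"
    and "real t \<ge> Psi (B_tilde f xstar (B 0))
           + 3 * C_of M \<mu> f xstar (x 0) * Psi (B_bar L (B 0))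
           + 9 / (\<alpha> * (1 - \<beta>)) * C_of M \<mu> f xstar (x 0) * \<kappa>"
  shows "(f (x t) - f xstar) / (f (x 0) - f xstar) \<le> (1 - 2 * \<alpha> * (1 - \<beta>) / 3) ^ t"
proof -
  note f = assms(1) and \<mu> = assms(2) and sc = assms(3) and L = assms(4) and lipg = assms(5)
    and M = assms(6) and liph = assms(7) and \<alpha> = assms(10,13) and \<beta>1 = assms(12)
    and B0 = assms(14) and seq = assms(15) and aw = assms(16)
  have \<beta>: "0 < \<beta>" "\<beta> < 1" using assms(10-12) by linarith+
  have min: "f xstar \<le> f z" for z using assms(9) by (simp add: is_arg_min_linorder)
  note inv = bfgs_sequence_invariant[OF seq B0 aw \<alpha>(1) \<beta>1]
  define h where "h i = f (x i) - f xstar" for i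
  have hpos: "h i > 0" for i using inv(3)[of i] min[of "x (Suc i)"] by (simp add: h_def)
  have hdec: "h (Suc i) \<le> h i" for i using inv(3)[of i] by (simp add: h_def)
  then have h0: "h i \<le> h 0" for i
    by (meson decseqD decseq_SucI le0)
  note hlow = strongly_convex_hessian_lower_bound[OF f sc]
  note hup = lipschitz_gradient_hessian_upper_bound[OF f lipg]
  have psd: "0 \<le> v \<bullet> (hessian f z *v v)" for v z
    using hlow[of v z] \<mu> by (meson mult_nonneg_nonneg less_imp_le order_trans zero_le_power2)
  have "\<mu> * (norm (axis undefined 1 :: real ^ 'n))\<^sup>2 \<le> L * (norm (axis undefined 1 :: real ^ 'n))\<^sup>2"
    using hlow hup by (rule order_trans)
  then have "\<mu> \<le> L" by simp
  then have \<kappa>: "\<kappa> \<ge> 1" using \<mu> by (simp add: assms(8))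

  \<comment> \<open>The rate in the metric \<open>L I\<close>. It deteriorates with \<open>\<kappa>\<close> but holds far away from \<open>x\<^sub>*\<close>, and it is
    what makes the numbers \<open>C\<^sub>i\<close> summable.\<close>
  have global: "h i \<le> (1 - 2 * \<alpha> * (1 - \<beta>) / (3 * \<kappa>)) ^ i * h 0" if i: "Psi (B_bar L (B 0)) \<le> i" for i
  proof -
    define S :: "real ^ 'n ^ 'n" where "S = sqrt L *\<^sub>R mat 1"
    define R :: "real ^ 'n ^ 'n" where "R = (1 / sqrt L) *\<^sub>R mat 1"
    have sL: "sqrt L > 0" using L by simp
    have Sv: "S *v v = sqrt L *\<^sub>R v" and Rv: "R *v v = (1 / sqrt L) *\<^sub>R v" for v
      by (simp_all add: S_def R_def scaleR_matrix_vector_assoc[symmetric])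
    have sym: "transpose R = R"
      by (simp add: R_def transpose_def vec_eq_iff mat_def)
    have RS: "R ** S = mat 1" "S ** R = mat 1"
      using sL by (simp_all add: matrix_eq matrix_vector_mul_assoc[symmetric] Rv Sv)
    have RBR: "R ** B 0 ** R = B_bar L (B 0)"
      using L by (simp add: matrix_eq matrix_vector_mul_assoc[symmetric] Rv B_bar_def
          matrix_vector_mult_scaleR scaleR_matrix_vector_assoc[symmetric])
    have nS: "(norm (S *v v))\<^sup>2 = L * (norm v)\<^sup>2" for v
      using L by (simp add: Sv power_mult_distrib)
    have "f (x i) - f xstar \<le> (1 - 2 * \<alpha> * (1 - \<beta>) * (1 / \<kappa>) / 3) ^ i * (f (x 0) - f xstar)"
    proof (rule bfgs_rate_in_metric[OF seq B0 aw \<alpha> \<beta> _ _ min sym RS(1),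
          where \<epsilon> = "\<lambda>_. 0" and \<delta> = "\<lambda>_. 0"])
      show "0 < 1 / \<kappa>" "1 / \<kappa> \<le> 1" using \<kappa> by simp_all
      show "Psi (R ** B 0 ** R) + (\<Sum>j<i. 0 + 0) \<le> i" using i by (simp add: RBR)
      fix j
      show "(norm (R *v (gradient f (x (Suc j)) - gradient f (x j))))\<^sup>2 \<le>
          (1 + 0) * ((x (Suc j) - x j) \<bullet> (gradient f (x (Suc j)) - gradient f (x j)))"
        using secant_cocoercive[OF f sym RS(2), of 1 "x j" "x (Suc j) - x j"] psd hup
        by (simp add: nS)
      have "2 * (\<mu> / L) * (f (x j) - f (x j + (xstar - x j))) \<le> (norm (R *v gradient f (x j)))\<^sup>2"
        using \<mu> L hlow sL
        by (intro gradient_domination[OF f sym RS(1)]) (simp_all add: Sv power_mult_distrib)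
      then show "2 * (1 / \<kappa> * exp (- 0)) * (f (x j) - f xstar) \<le> (norm (R *v gradient f (x j)))\<^sup>2"
        by (simp add: assms(8))
    qed
    then show ?thesis by (simp add: h_def mult.commute[of \<kappa>])
  qed

  define C where "C i = C_of M \<mu> f xstar (x i)" for i
  define K where "K = M / \<mu> powr (3 / 2) * sqrt 2"
  have K: "K > 0" using M \<mu> by (simp add: K_def)
  have CK: "C i = K * sqrt (h i)" for i
    unfolding C_def C_of_def K_def h_def[symmetric] real_sqrt_mult by simp
  have C: "C i \<ge> 0" for i using K hpos[of i] by (simp add: CK)
  have sumC: "(\<Sum>i<t. C i) \<le> C 0 * (Psi (B_bar L (B 0)) + 3 * \<kappa> / (\<alpha> * (1 - \<beta>)))"
  proof -
    define r where "r = 1 - 2 * \<alpha> * (1 - \<beta>) / (3 * \<kappa>)"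
    have ab: "0 < \<alpha> * (1 - \<beta>)" using \<alpha> \<beta> by simp
    have "(2 * \<alpha>) * (1 - \<beta>) \<le> 1 * 1" using \<alpha> \<beta> by (intro mult_mono) simp_all
    then have r: "0 \<le> r" "r < 1"
      using \<kappa> ab by (simp_all add: r_def field_simps)
    have "spd (B_bar L (B 0))"
      using B0 L unfolding B_bar_def spd_def
      by (simp add: scaleR_matrix_vector_assoc[symmetric] transpose_def vec_eq_iff)
    then have "(\<Sum>i<t. sqrt (h i)) \<le> sqrt (h 0) * (Psi (B_bar L (B 0)) + 2 / (1 - r))"
      using hpos h0 r global
      by (intro sum_sqrt_eventually_geometric Psi_nonneg) (auto simp: less_imp_le r_def)
    then have "K * (\<Sum>i<t. sqrt (h i)) \<le> K * (sqrt (h 0) * (Psi (B_bar L (B 0)) + 2 / (1 - r)))"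
      using K by (intro mult_left_mono) simp_all
    moreover have "2 / (1 - r) = 3 * \<kappa> / (\<alpha> * (1 - \<beta>))"
    proof -
      define p where "p = \<alpha> * (1 - \<beta>)"
      have gap: "1 - r = 2 * p / (3 * \<kappa>)" by (simp add: r_def p_def mult.assoc)
      show ?thesis
        using ab \<kappa> unfolding gap p_def[symmetric] by (simp add: field_simps)
    qed
    ultimately show ?thesis by (simp add: CK sum_distrib_left mult.assoc)
  qed

  \<comment> \<open>By strong convexity, \<open>x\<^sub>i\<close> lies in the ball of radius \<open>sqrt (2 h\<^sub>i / \<mu>)\<close> around \<open>x\<^sub>*\<close>, where the
    Hessian deviates by at most \<open>\<mu> C\<^sub>i\<close>. The ball is convex and contains also \<open>x\<^sub>i\<^sub>+\<^sub>1\<close> and \<open>x\<^sub>*\<close>, hence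
    the two segments along which curvature is needed.\<close>
  have near: "M * norm (z - xstar) \<le> \<mu> * C i" if z: "norm (z - xstar) \<le> sqrt (2 * h i / \<mu>)" for z i
  proof -
    have "M * norm (z - xstar) \<le> M * sqrt (2 * h i / \<mu>)"
      using z M by (intro mult_left_mono) simp_all
    also have "\<dots> = \<mu> * C i"
    proof -
      have "\<mu> powr (3 / 2) = \<mu> powr (1 + 1 / 2)" by simp
      also have "\<dots> = \<mu> * sqrt \<mu>" using \<mu> by (simp only: powr_add powr_half_sqrt) simp
      finally have "\<mu> powr (3 / 2) = \<mu> * sqrt \<mu>" .
      then show ?thesis using \<mu> by (simp add: CK K_def real_sqrt_mult real_sqrt_divide)
    qed
    finally show ?thesis .
  qed
  have ball: "norm (x i - xstar) \<le> sqrt (2 * h i / \<mu>)" for i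
  proof (rule real_le_rsqrt)
    show "(norm (x i - xstar))\<^sup>2 \<le> 2 * h i / \<mu>"
      using strongly_convex_growth[OF f sc min, of "x i"] \<mu> by (simp add: h_def field_simps)
  qed
  have ball_segment: "norm (x i + r *\<^sub>R (z - x i) - xstar) \<le> sqrt (2 * h i / \<mu>)"
    if z: "norm (z - xstar) \<le> sqrt (2 * h i / \<mu>)" and r: "0 \<le> r" "r \<le> 1" for i z r
  proof -
    have "(1 - r) *\<^sub>R x i + r *\<^sub>R z \<in> cball xstar (sqrt (2 * h i / \<mu>))"
      using z ball[of i] r
      by (intro convexD_alt[OF convex_cball]) (simp_all add: dist_norm norm_minus_commute)
    then show ?thesis by (simp add: dist_norm norm_minus_commute algebra_simps)
  qed
  have relative: "v \<bullet> (hessian f (x i + r *\<^sub>R (z - x i)) *v v) \<le> (1 + C i) * (v \<bullet> (hessian f xstar *v v))"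
      "v \<bullet> (hessian f xstar *v v) \<le> (1 + C i) * (v \<bullet> (hessian f (x i + r *\<^sub>R (z - x i)) *v v))"
    if "norm (z - xstar) \<le> sqrt (2 * h i / \<mu>)" "0 \<le> r" "r \<le> 1" for i z r v
    using relative_hessian_bounds[OF f sc \<mu> M liph near[OF ball_segment[OF that]]] by auto

  \<comment> \<open>The metric given by the Hessian at \<open>x\<^sub>*\<close>, in which the problem is well conditioned up to the
    errors \<open>C\<^sub>i\<close>.\<close>
  define H where "H = hessian f xstar"
  define S where "S = spd_sqrt H"
  define R where "R = matrix_inv S"
  have "v \<bullet> (H *v v) > 0" if "v \<noteq> 0" for v
    using hlow[of v xstar] \<mu> that unfolding H_def
    by (meson less_le_trans mult_pos_pos zero_less_power2 norm_eq_zero)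
  then have H: "spd H" by (simp add: spd_def H_def hessian_symmetric[OF f])
  have spdS: "spd S" and SS: "S ** S = H"
    using spd_spd_sqrt[OF H] spd_sqrt_square[OF H] by (simp_all add: S_def)
  have SR: "S ** R = mat 1" and RS: "R ** S = mat 1"
    unfolding R_def by (rule spd_matrix_inv[OF spdS])+
  have S: "transpose S = S" using spdS by (simp add: spd_def)
  have "transpose R = transpose R ** (S ** R)" by (simp add: SR)
  also have "\<dots> = transpose (S ** R) ** R" by (simp add: matrix_transpose_mul S matrix_mul_assoc)
  finally have R: "transpose R = R" by (simp add: SR transpose_mat)
  have nS: "(norm (S *v v))\<^sup>2 = v \<bullet> (H *v v)" for v
    unfolding SS[symmetric] power2_norm_eq_inner
    by (simp add: matrix_vector_mul_assoc[symmetric] inner_matrix_vector_transpose[of v S] S)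

  have "f (x t) - f xstar \<le> (1 - 2 * \<alpha> * (1 - \<beta>) * 1 / 3) ^ t * (f (x 0) - f xstar)"
  proof (rule bfgs_rate_in_metric[OF seq B0 aw \<alpha> \<beta> _ _ min R RS, where \<epsilon> = C and \<delta> = C])
    fix i
    have "norm (x (Suc i) - xstar) \<le> sqrt (2 * h i / \<mu>)"
      using hdec[of i] \<mu> by (intro order_trans[OF ball]) (simp add: divide_right_mono)
    note rel = relative[OF this]
    show "(norm (R *v (gradient f (x (Suc i)) - gradient f (x i))))\<^sup>2 \<le>
        (1 + C i) * ((x (Suc i) - x i) \<bullet> (gradient f (x (Suc i)) - gradient f (x i)))"
      using secant_cocoercive[OF f R SR, of "1 + C i" "x i" "x (Suc i) - x i"] psd rel(1) C[of i]
      by (simp add: nS H_def)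
    have c: "1 / (1 + C i) > 0" using C[of i] by simp
    have "2 * (1 / (1 + C i)) * (f (x i) - f (x i + (xstar - x i))) \<le> (norm (R *v gradient f (x i)))\<^sup>2"
    proof (rule gradient_domination[OF f R RS c])
      fix r :: real assume "0 \<le> r" "r \<le> 1"
      then show "1 / (1 + C i) * (norm (S *v (xstar - x i)))\<^sup>2 \<le>
          (xstar - x i) \<bullet> (hessian f (x i + r *\<^sub>R (xstar - x i)) *v (xstar - x i))"
        using relative(2)[of xstar i r "xstar - x i"] hpos[of i] \<mu> C[of i]
        by (simp add: nS H_def field_simps)
    qed
    moreover have "2 * (1 * exp (- C i)) * h i \<le> 2 * (1 / (1 + C i)) * h i"
    proof -
      have "exp (- C i) \<le> 1 / (1 + C i)"
        using exp_ge_add_one_self[of "C i"] C[of i] by (simp add: exp_minus field_simps)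
      then show ?thesis using hpos[of i] by (intro mult_right_mono) simp_all
    qed
    ultimately show "2 * (1 * exp (- C i)) * (f (x i) - f xstar) \<le> (norm (R *v gradient f (x i)))\<^sup>2"
      by (simp add: h_def)
  next
    \<comment> \<open>Each iteration has an error of at most \<open>C\<^sub>i\<close> in the secant pair and one of at most
      \<open>ln (1 + C\<^sub>i) \<le> C\<^sub>i\<close> in gradient domination; the threshold for \<open>t\<close> covers three times \<open>C\<^sub>i\<close>.\<close>
    have "(\<Sum>i<t. C i + C i) \<le> 3 * (\<Sum>i<t. C i)"
      unfolding sum_distrib_left using C by (intro sum_mono) simp
    also have "\<dots> \<le> 3 * (C 0 * (Psi (B_bar L (B 0)) + 3 * \<kappa> / (\<alpha> * (1 - \<beta>))))"
      using sumC by simp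
    also have "\<dots> = 3 * C 0 * Psi (B_bar L (B 0)) + 9 / (\<alpha> * (1 - \<beta>)) * C 0 * \<kappa>"
      by (simp add: distrib_left mult_ac)
    finally show "Psi (R ** B 0 ** R) + (\<Sum>i<t. C i + C i) \<le> t"
      using assms(17) by (simp add: B_tilde_def Let_def R_def S_def H_def C_def)
  qed simp_all
  then show ?thesis using hpos[of 0] by (simp add: h_def divide_le_eq)
qed

end
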